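(* There exists a (deterministic) algorithm $\mathbb{A}$ such that for each fixed integer $k\ge 3$ the following holds. Given as input a $k$-graph $H\in\mathcal{B}_n$, where $\mathcal{B}_n=\mathcal{B}_n^{(k)}$ is the class of all bipartite $k$-graphs with vertex set $[n]$, the algorithm $\mathbb{A}$ always constructs a bipartition $[n]=X_H\,\dot\cup\,Y_H$ of $H$, and its running time averages $O(n^k)$ over the class $\mathcal{B}_n$; that is, if $\tau_{\mathbb{A}}(H)$ denotes the running time of $\mathbb{A}$ on $H$, then $$\frac{1}{|\mathcal{B}_n|}\sum_{H\in\mathcal{B}_n}\tau_{\mathbb{A}}(H)=O(n^k)\qquad (n\to\infty),$$ where the implied constant depends only on $k$.
   Context: A $k$-uniform hypergraph ($k$-graph) $H$ is a pair $(V_H,E_H)$ with $E_H\subseteq\binom{V_H}{k}$, a family of $k$-element subsets of $V_H$. $H$ is bipartite if there is a partition $V_H=X_H\,\dot\cup\,Y_H$, called a bipartition (or 2-coloring) of $H$, such that both $X_H$ and $Y_H$ meet every edge $e\in E_H$ (equivalently, neither $X_H$ nor $Y_H$ contains an edge of $H$). $\mathcal{B}_n=\mathcal{B}_n^{(k)}$ is the class of all bipartite $k$-graphs with the fixed labelled vertex set $[n]=\{1,\dots,n\}$. The input consists of $H$ only; no bipartition is given. Running time is the number of elementary operations, where a query of whether a given $k$-set is an edge of $H$ counts as one operation. *)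

theory Defs
  imports Complex_Main "HOL-Library.Ramsey" "HOL-Library.Landau_Symbols"
begin

section \<open>Hypergraphs\<close>

text \<open>A hypergraph is a pair of a vertex set and a set of edges;
  \<^term>\<open>nsets V k\<close> is the set of all \<open>k\<close>-element subsets of \<open>V\<close>.\<close>

type_synonym hypergraph = "nat set \<times> nat set set"

definition kgraph :: "nat \<Rightarrow> hypergraph \<Rightarrow> bool" where
  "kgraph k H \<longleftrightarrow> snd H \<subseteq> nsets (fst H) k"

definition bipartition :: "hypergraph \<Rightarrow> nat set \<Rightarrow> nat set \<Rightarrow> bool" where
  "bipartition H X Y \<longleftrightarrow>
     X \<union> Y = fst H \<and> X \<inter> Y = {} \<and> (\<forall>e\<in>snd H. e \<inter> X \<noteq> {} \<and> e \<inter> Y \<noteq> {})"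

definition bipartite :: "hypergraph \<Rightarrow> bool" where
  "bipartite H \<longleftrightarrow> (\<exists>X Y. bipartition H X Y)"

definition bip_class :: "nat \<Rightarrow> nat \<Rightarrow> hypergraph set" where
  "bip_class k n = {H. fst H = {1..n} \<and> kgraph k H \<and> bipartite H}"

lemma finite_bip_class: "finite (bip_class k n)"
proof (rule finite_subset)
  show "bip_class k n \<subseteq> {{1..n}} \<times> Pow (Pow {1..n})"
  proof
    fix H assume "H \<in> bip_class k n"
    then have "fst H = {1..n}" and "snd H \<subseteq> Pow {1..n}"
      unfolding bip_class_def kgraph_def nsets_def by blast+
    then show "H \<in> {{1..n}} \<times> Pow (Pow {1..n})"
      by (simp add: mem_Times_iff)
  qed
qed auto

lemma bip_class_nonempty: "bip_class k n \<noteq> {}"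
proof -
  have "({1..n}, {}) \<in> bip_class k n"
    by (auto simp: bip_class_def kgraph_def bipartite_def bipartition_def)
  then show ?thesis by blast
qed


section \<open>Algorithms\<close>

text \<open>
  Algorithms are programs for a structured random access machine: finitely many registers and
  arrays holding natural numbers, with addition, truncated subtraction, comparison and indexed
  array access as elementary operations. There is deliberately no unit-cost multiplication:
  on unbounded numbers it is not an elementary operation. The input hypergraph is
  accessible only through \<open>Query\<close>. A program is a finite object that depends neither
  on the number of vertices nor on the uniformity \<open>k\<close>; it finds both in registers.
\<close>

datatype aexp =
    Num nat
  | Var nat
  | Load nat aexp  \<comment> \<open>\<open>Load A a\<close> is the entry of array \<open>A\<close> at index \<open>a\<close>\<close>
  | Add aexp aexp
  | Sub aexp aexp

datatype bexp = Less aexp aexp | Equal aexp aexp | Neg bexp | Conj bexp bexp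

datatype com =
    Skip
  | Assign nat aexp
  | Store nat aexp aexp  \<comment> \<open>\<open>Store A a b\<close> writes \<open>b\<close> to array \<open>A\<close> at index \<open>a\<close>\<close>
  | Query nat nat aexp
  | Seq com com
  | Cond bexp com com
  | While bexp com

record state =
  reg :: "nat \<Rightarrow> nat"
  arr :: "nat \<Rightarrow> nat \<Rightarrow> nat"

fun aval :: "aexp \<Rightarrow> state \<Rightarrow> nat" where
  "aval (Num m) s = m"
| "aval (Var x) s = reg s x"
| "aval (Load A a) s = arr s A (aval a s)"
| "aval (Add a b) s = aval a s + aval b s"
| "aval (Sub a b) s = aval a s - aval b s"

fun bval :: "bexp \<Rightarrow> state \<Rightarrow> bool" where
  "bval (Less a b) s \<longleftrightarrow> aval a s < aval b s"
| "bval (Equal a b) s \<longleftrightarrow> aval a s = aval b s"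
| "bval (Neg b) s \<longleftrightarrow> \<not> bval b s"
| "bval (Conj b c) s \<longleftrightarrow> bval b s \<and> bval c s"

fun acost :: "aexp \<Rightarrow> nat" where
  "acost (Num m) = 1"
| "acost (Var x) = 1"
| "acost (Load A a) = 1 + acost a"
| "acost (Add a b) = 1 + acost a + acost b"
| "acost (Sub a b) = 1 + acost a + acost b"

fun bcost :: "bexp \<Rightarrow> nat" where
  "bcost (Less a b) = 1 + acost a + acost b"
| "bcost (Equal a b) = 1 + acost a + acost b"
| "bcost (Neg b) = 1 + bcost b"
| "bcost (Conj b c) = 1 + bcost b + bcost c"

text \<open>
  \<open>exec k E c s t s'\<close>: with edge oracle \<open>E\<close>, program \<open>c\<close> started in \<open>s\<close> terminates in \<open>s'\<close>
  after \<open>t\<close> elementary operations. \<open>Query x A a\<close> asks whether the set of the \<open>k\<close> consecutive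
  entries of array \<open>A\<close> starting at index \<open>a\<close> is an edge, and puts the answer (1 or 0) into
  register \<open>x\<close>. The query itself is a single operation; its arguments have to be stored in
  \<open>A\<close> beforehand. If the entries are not distinct, the answer is 0 for a \<open>k\<close>-graph.
\<close>

inductive exec :: "nat \<Rightarrow> nat set set \<Rightarrow> com \<Rightarrow> state \<Rightarrow> nat \<Rightarrow> state \<Rightarrow> bool"
  for k :: nat and E :: "nat set set" where
  Skip: "exec k E Skip s 1 s"
| Assign: "exec k E (Assign x a) s (1 + acost a) (s\<lparr>reg := (reg s)(x := aval a s)\<rparr>)"
| Store: "exec k E (Store A a b) s (1 + acost a + acost b)
    (s\<lparr>arr := (arr s)(A := (arr s A)(aval a s := aval b s))\<rparr>)"
| Query: "exec k E (Query x A a) s (1 + acost a)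
    (s\<lparr>reg := (reg s)(x := if (\<lambda>i. arr s A (aval a s + i)) ` {..<k} \<in> E then 1 else 0)\<rparr>)"
| Seq: "exec k E c s t s' \<Longrightarrow> exec k E d s' u s'' \<Longrightarrow> exec k E (Seq c d) s (t + u) s''"
| CondTrue: "bval b s \<Longrightarrow> exec k E c s t s' \<Longrightarrow> exec k E (Cond b c d) s (1 + bcost b + t) s'"
| CondFalse: "\<not> bval b s \<Longrightarrow> exec k E d s t s' \<Longrightarrow> exec k E (Cond b c d) s (1 + bcost b + t) s'"
| WhileFalse: "\<not> bval b s \<Longrightarrow> exec k E (While b c) s (1 + bcost b) s"
| WhileTrue: "bval b s \<Longrightarrow> exec k E c s t s' \<Longrightarrow> exec k E (While b c) s' u s'' \<Longrightarrow>
    exec k E (While b c) s (1 + bcost b + t + u) s''"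

inductive_cases SkipE: "exec k E Skip s t s'"
inductive_cases AssignE: "exec k E (Assign x a) s t s'"
inductive_cases StoreE: "exec k E (Store A a b) s t s'"
inductive_cases QueryE: "exec k E (Query x A a) s t s'"
inductive_cases SeqE: "exec k E (Seq c d) s t s'"
inductive_cases CondE: "exec k E (Cond b c d) s t s'"
inductive_cases WhileE: "exec k E (While b c) s t s'"

lemma exec_deterministic:
  "exec k E c s t s' \<Longrightarrow> exec k E c s u s'' \<Longrightarrow> u = t \<and> s'' = s'"
proof (induction arbitrary: u s'' rule: exec.induct)
  case Skip
  then show ?case by (rule SkipE) simp
next
  case Assign
  then show ?case by (rule AssignE) simp
next
  case Store
  then show ?case by (rule StoreE) simp
next
  case Query
  then show ?case by (rule QueryE) simp
next
  case Seq
  from Seq.prems show ?case by (rule SeqE) (auto dest!: Seq.IH)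
next
  case CondTrue
  from CondTrue.prems show ?case by (rule CondE) (use CondTrue.hyps(1) in \<open>auto dest!: CondTrue.IH\<close>)
next
  case CondFalse
  from CondFalse.prems show ?case by (rule CondE) (use CondFalse.hyps(1) in \<open>auto dest!: CondFalse.IH\<close>)
next
  case WhileFalse
  from WhileFalse.prems show ?case by (rule WhileE) (use WhileFalse.hyps in simp_all)
next
  case WhileTrue
  from WhileTrue.prems show ?case by (rule WhileE) (use WhileTrue.hyps(1) in \<open>auto dest!: WhileTrue.IH\<close>)
qed

text \<open>Initially register 0 holds \<open>n\<close>, register 1 holds \<open>k\<close>, and everything else is 0.\<close>

definition init_state :: "nat \<Rightarrow> nat \<Rightarrow> state" where
  "init_state k n = \<lparr>reg = (\<lambda>_. 0)(0 := n, 1 := k), arr = (\<lambda>_ _. 0)\<rparr>"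

definition run :: "com \<Rightarrow> nat \<Rightarrow> hypergraph \<Rightarrow> nat \<Rightarrow> state \<Rightarrow> bool" where
  "run P k H t s \<longleftrightarrow> exec k (snd H) P (init_state k (card (fst H))) t s"

text \<open>By \<open>exec_deterministic\<close> there is at most one such \<open>t\<close>.\<close>

definition running_time :: "com \<Rightarrow> nat \<Rightarrow> hypergraph \<Rightarrow> nat" where
  "running_time P k H = (THE t. \<exists>s. run P k H t s)"

text \<open>The output is the 0/nonzero colouring of the vertices in array 0.\<close>

definition colour_X :: "hypergraph \<Rightarrow> state \<Rightarrow> nat set" where
  "colour_X H s = {v \<in> fst H. arr s 0 v = 0}"

definition colour_Y :: "hypergraph \<Rightarrow> state \<Rightarrow> nat set" where
  "colour_Y H s = {v \<in> fst H. arr s 0 v \<noteq> 0}"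

end

theory Submission
  imports Defs "HOL-Analysis.Convex"
begin

text \<open>
  The algorithm is plain backtracking: colour the vertices in the order \<open>1, \<dots>, n\<close>, check each new
  colour against the edges whose largest vertex is the new one, at cost \<open>O(m\<^sup>k\<^sup>-\<^sup>1)\<close> on level \<open>m\<close>, and
  step back on failure. Its running time is governed by the number of proper colourings of the
  restrictions of \<open>H\<close> to \<open>{1..m}\<close>.

  On average over the class this number is bounded, up to an error \<open>O(n (3/4)\<^sup>m)\<close>. Count
  triples of a graph, a colouring \<open>X\<close> of \<open>{1..n}\<close> and a colouring \<open>c\<close> of \<open>{1..m}\<close>, both proper. If
  \<open>X\<close> splits a class of \<open>c\<close> of size \<open>t\<close>, then at least \<open>(t - 1) choose (k - 1)\<close> further
  \<open>k\<close>-sets are forbidden as edges, which outweighs all choices within that class.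
  Otherwise \<open>X\<close> restricted to \<open>{1..m}\<close> is \<open>c\<close> up to swapping, or it is constant; the
  latter has weight at most \<open>2\<^sup>-\<^sup>m\<close> of the total since balanced colourings are the heaviest.
  The case \<open>m = n\<close> bounds the second moment of the number of colourings, so by Cauchy's inequality
  the number of pairs of a graph and a colouring exceeds the number of graphs by at most a constant factor.
\<close>

section \<open>Time-bounded total correctness\<close>

text \<open>Termination within the budget \<open>b\<close> is part of the claim. One witnessing
  execution is enough, since by \<open>exec_deterministic\<close> it is the only one.\<close>

definition wp :: "nat \<Rightarrow> nat set set \<Rightarrow> com \<Rightarrow> nat \<Rightarrow> (state \<Rightarrow> bool) \<Rightarrow> state \<Rightarrow> bool" where
  "wp k E c b Q s \<longleftrightarrow> (\<exists>t s'. exec k E c s t s' \<and> t \<le> b \<and> Q s')"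

lemma wp_mono: "wp k E c b Q s \<Longrightarrow> b \<le> b' \<Longrightarrow> (\<And>s'. Q s' \<Longrightarrow> Q' s') \<Longrightarrow> wp k E c b' Q' s"
  unfolding wp_def using le_trans by blast

lemma wp_Skip: "Q s \<Longrightarrow> 1 \<le> b \<Longrightarrow> wp k E Skip b Q s"
  unfolding wp_def using exec.Skip by blast

lemma wp_Assign:
  "Q (s\<lparr>reg := (reg s)(x := aval a s)\<rparr>) \<Longrightarrow> 1 + acost a \<le> b \<Longrightarrow> wp k E (Assign x a) b Q s"
  unfolding wp_def using exec.Assign by blast

lemma wp_Store:
  "Q (s\<lparr>arr := (arr s)(A := (arr s A)(aval a s := aval b s))\<rparr>) \<Longrightarrow> 1 + acost a + acost b \<le> t \<Longrightarrow>
    wp k E (Store A a b) t Q s"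
  unfolding wp_def using exec.Store by blast

lemma wp_Query:
  "Q (s\<lparr>reg := (reg s)(x := if (\<lambda>i. arr s A (aval a s + i)) ` {..<k} \<in> E then 1 else 0)\<rparr>) \<Longrightarrow>
    1 + acost a \<le> b \<Longrightarrow> wp k E (Query x A a) b Q s"
  unfolding wp_def using exec.Query by blast

lemma wp_Seq: "wp k E c t (wp k E d u Q) s \<Longrightarrow> t + u \<le> b \<Longrightarrow> wp k E (Seq c d) b Q s"
  unfolding wp_def using exec.Seq by (meson add_le_mono le_trans)

lemma wp_Cond:
  assumes "bval b s \<Longrightarrow> wp k E c t Q s" and "\<not> bval b s \<Longrightarrow> wp k E d t Q s"
    and "1 + bcost b + t \<le> u"
  shows "wp k E (Cond b c d) u Q s"
proof (cases "bval b s")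
  case True
  then obtain v s' where "exec k E c s v s'" "v \<le> t" "Q s'"
    using assms(1) unfolding wp_def by blast
  with CondTrue[of b s k E c v s' d] True assms(3) show ?thesis
    unfolding wp_def by (intro exI[of _ "1 + bcost b + v"] exI[of _ s']) auto
next
  case False
  then obtain v s' where "exec k E d s v s'" "v \<le> t" "Q s'"
    using assms(2) unfolding wp_def by blast
  with CondFalse[of b s k E d v s' c] False assms(3) show ?thesis
    unfolding wp_def by (intro exI[of _ "1 + bcost b + v"] exI[of _ s']) auto
qed

lemma wp_While_False:
  "\<not> bval b s \<Longrightarrow> Q s \<Longrightarrow> 1 + bcost b \<le> t \<Longrightarrow> wp k E (While b c) t Q s"
  unfolding wp_def using exec.WhileFalse by blast

text \<open>Unrolls a single round. The search loop is verified with this rule, by induction along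
  the search tree, rather than with an invariant.\<close>

lemma wp_While_True:
  assumes "bval b s" and "wp k E c t (wp k E (While b c) u Q) s" and "1 + bcost b + t + u \<le> v"
  shows "wp k E (While b c) v Q s"
proof -
  obtain t' s' u' s'' where "exec k E c s t' s'" "t' \<le> t" "exec k E (While b c) s' u' s''" "u' \<le> u" "Q s''"
    using assms(2) unfolding wp_def by blast
  with WhileTrue[OF assms(1), of k E c t' s' u' s''] assms(3) show ?thesis
    unfolding wp_def by (intro exI[of _ "1 + bcost b + t' + u'"] exI[of _ s'']) auto
qed

text \<open>The index of the invariant is also the variant. It drops in every round, so at most
  \<open>i\<close> rounds of cost \<open>1 + bcost b + B\<close> and one failing test have to be
  paid.\<close>

lemma wp_While:
  assumes "I i s"
    and step: "\<And>i s. I i s \<Longrightarrow> bval b s \<Longrightarrow> wp k E c B (\<lambda>s'. \<exists>j<i. I j s') s"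
    and exit: "\<And>i s. I i s \<Longrightarrow> \<not> bval b s \<Longrightarrow> Q s"
    and "i * (1 + bcost b + B) + 1 + bcost b \<le> t"
  shows "wp k E (While b c) t Q s"
  using assms(1,4)
proof (induction i arbitrary: s t rule: less_induct)
  case (less i)
  show ?case
  proof (cases "bval b s")
    case True
    let ?u = "(i - 1) * (1 + bcost b + B) + 1 + bcost b"
    have *: "wp k E (While b c) ?u Q s'" if "j < i" "I j s'" for j s'
    proof (rule wp_mono[OF less.IH[OF that order_refl]])
      have "j * (1 + bcost b + B) \<le> (i - 1) * (1 + bcost b + B)"
        using that by (intro mult_right_mono) auto
      then show "j * (1 + bcost b + B) + 1 + bcost b \<le> ?u" by simp
    qed
    have "wp k E c B (\<lambda>s'. \<exists>j<i. I j s') s" by (rule step[OF less.prems(1) True])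
    then have w: "wp k E c B (wp k E (While b c) ?u Q) s"
      by (rule wp_mono) (use * in auto)
    \<comment> \<open>The body terminates in a state that exhibits some
      \<open>j < i\<close>.\<close>
    moreover have "i > 0" using \<open>wp k E c B (\<lambda>s'. \<exists>j<i. I j s') s\<close> unfolding wp_def by auto
    then have "i * (1 + bcost b + B) = (i - 1) * (1 + bcost b + B) + (1 + bcost b + B)"
      by (cases i) auto
    then have "1 + bcost b + B + ?u \<le> t" using less.prems(2) by linarith
    ultimately show ?thesis by (intro wp_While_True[OF True w])
  next
    case False
    then show ?thesis using less.prems exit by (intro wp_While_False) auto
  qed
qed

section \<open>Base-\<open>m\<close> arithmetic of the odometer\<close>

text \<open>The tuples are enumerated in base \<open>m\<close>; array positions, and hence digits, are counted from 1.\<close>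

definition digit :: "nat \<Rightarrow> nat \<Rightarrow> nat \<Rightarrow> nat" where
  "digit m v i = v div m ^ (i - 1) mod m + 1"

text \<open>Position 0 is reserved for \<open>m\<close>, the largest vertex. A tuple with
  repetitions yields fewer than \<open>k\<close> vertices and is therefore never an edge, so the
  odometer may run through all tuples.\<close>

definition tuple_set :: "nat \<Rightarrow> nat \<Rightarrow> nat \<Rightarrow> nat set" where
  "tuple_set k m v = insert m (digit m v ` {1..<k})"

text \<open>Existence of base-\<open>m\<close> expansions; the induction adds a most significant
  digit.\<close>

lemma digit_surj:
  assumes "m \<ge> 1" and "\<And>i. i \<in> {1..<Suc d} \<Longrightarrow> f i \<in> {1..m}"
  shows "\<exists>v<m ^ d. \<forall>i\<in>{1..<Suc d}. digit m v i = f i"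
  using assms(2)
proof (induction d)
  case 0
  then show ?case by simp
next
  case (Suc d)
  then obtain v where v: "v < m ^ d" "\<forall>i\<in>{1..<Suc d}. digit m v i = f i" by fastforce
  define w where "w = v + (f (Suc d) - 1) * m ^ d"
  have fd: "f (Suc d) \<in> {1..m}" using Suc.prems by simp
  then have "f (Suc d) - 1 \<le> m - 1" by auto
  then have "w < m ^ d + (m - 1) * m ^ d"
    unfolding w_def using v(1) by (intro add_less_le_mono mult_right_mono) auto
  also have "\<dots> = m ^ Suc d" using assms(1) by (cases m) simp_all
  finally have "w < m ^ Suc d" .
  moreover have "digit m w i = f i" if "i \<in> {1..<Suc (Suc d)}" for i
  proof (cases "i = Suc d")
    case True
    have "w div m ^ d = f (Suc d) - 1" unfolding w_def using v(1) assms(1) by simp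
    then show ?thesis using True fd by (auto simp: digit_def)
  next
    case False
    then have i: "i \<in> {1..<Suc d}" using that by auto
    then have "m ^ d = m ^ ((i - 1) + Suc (d - i))" by (intro arg_cong[of _ _ "power m"]) auto
    then have "m ^ d = m ^ (i - 1) * (m * m ^ (d - i))" by (simp only: power_add power_Suc)
    \<comment> \<open>The added term is a multiple of \<open>m ^ i\<close>. After division by
      \<open>m ^ (i - 1)\<close> it is still a multiple of \<open>m\<close> and leaves the digit
      unchanged.\<close>
    then have "w = v + m ^ (i - 1) * (m * (m ^ (d - i) * (f (Suc d) - 1)))"
      unfolding w_def by (simp only: mult_ac)
    then have "w div m ^ (i - 1) = v div m ^ (i - 1) + m * (m ^ (d - i) * (f (Suc d) - 1))"
      using assms(1) by simp
    then have "digit m w i = digit m v i" unfolding digit_def by simp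
    then show ?thesis using v(2) i by simp
  qed
  ultimately show ?case by blast
qed

lemma digit_range: "m \<ge> 1 \<Longrightarrow> digit m v i \<in> {1..m}"
  by (simp add: digit_def Suc_leI)

text \<open>The odometer meets every \<open>k\<close>-set with maximum \<open>m\<close>, once for
  each ordering of its other \<open>k - 1\<close> vertices, and no other
  \<open>k\<close>-set.\<close>

lemma tuple_set_iff:
  assumes "m \<ge> 1" "k \<ge> 1" "card e = k"
  shows "(\<exists>v<m ^ (k - 1). tuple_set k m v = e) \<longleftrightarrow> e \<subseteq> {1..m} \<and> m \<in> e"
proof
  assume "\<exists>v<m ^ (k - 1). tuple_set k m v = e"
  then obtain v where v: "e = insert m (digit m v ` {1..<k})" unfolding tuple_set_def by blast
  have "digit m v ` {1..<k} \<subseteq> {1..m}" using digit_range[OF assms(1)] by blast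
  then show "e \<subseteq> {1..m} \<and> m \<in> e" unfolding v using assms(1) by simp
next
  assume e: "e \<subseteq> {1..m} \<and> m \<in> e"
  then have "finite e" using finite_subset by blast
  then have "card (e - {m}) = k - 1" using e assms(3) by simp
  moreover have "card {1..<k} = k - 1" by simp
  ultimately obtain f where f: "bij_betw f {1..<k} (e - {m})"
    using \<open>finite e\<close> finite_same_card_bij[of "{1..<k}" "e - {m}"] by auto
  have k: "Suc (k - 1) = k" using assms(2) by simp
  have "f i \<in> {1..m}" if "i \<in> {1..<Suc (k - 1)}" for i
  proof -
    have "i \<in> {1..<k}" using that unfolding k .
    then have "f i \<in> e - {m}" by (rule bij_betwE[OF f, rule_format])
    then show ?thesis using e by blast
  qed
  from digit_surj[of m "k - 1" f, OF assms(1) this]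
  obtain v where v: "v < m ^ (k - 1)" "\<forall>i\<in>{1..<k}. digit m v i = f i" unfolding k by blast
  then have "digit m v ` {1..<k} = f ` {1..<k}" by (intro image_cong) auto
  then have "digit m v ` {1..<k} = e - {m}" using f by (simp add: bij_betw_def)
  then have "tuple_set k m v = e" using e unfolding tuple_set_def by blast
  then show "\<exists>v<m ^ (k - 1). tuple_set k m v = e" using v(1) by blast
qed

text \<open>The first assumption says that the carry of \<open>v + 1\<close> reaches position
  \<open>i\<close>. It passes on exactly if the digit there is \<open>m\<close>, and otherwise stops
  by raising that digit. The next two lemmas treat the positions below, which are reset, and those
  above the stop, which are untouched.\<close>

lemma digit_carry:
  assumes "Suc v mod m ^ (i - 1) = 0" "1 \<le> i" "m \<ge> 1"
  shows "digit m v i = m \<longleftrightarrow> Suc v mod m ^ i = 0"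
    and "digit m v i \<noteq> m \<Longrightarrow> digit m (Suc v) i = Suc (digit m v i)"
proof -
  let ?M = "m ^ (i - 1)"
  have M: "m ^ i = ?M * m" using assms(2) by (cases i) simp_all
  have s: "Suc v div ?M = Suc (v div ?M)" using assms(1) by (simp add: div_Suc)
  have "Suc v mod m ^ i = ?M * (Suc v div ?M mod m)"
    unfolding M using assms(1) by (simp add: mod_mult2_eq)
  then have z: "Suc v mod m ^ i = 0 \<longleftrightarrow> Suc (v div ?M) mod m = 0" using assms(3) s by simp
  show "digit m v i = m \<longleftrightarrow> Suc v mod m ^ i = 0"
    unfolding z digit_def by (simp add: mod_Suc)
  show "digit m (Suc v) i = Suc (digit m v i)" if "digit m v i \<noteq> m"
    using that unfolding digit_def s by (simp add: mod_Suc)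
qed

lemma digit_Suc_below:
  assumes "Suc v mod m ^ (i - 1) = 0" "1 \<le> j" "j < i" "m \<ge> 1"
  shows "digit m (Suc v) j = 1"
proof -
  have "m ^ (i - 1) = m ^ ((j - 1) + Suc (i - Suc j))"
    using assms(2,3) by (intro arg_cong[of _ _ "power m"]) auto
  then have e: "m ^ (i - 1) = m ^ (j - 1) * (m * m ^ (i - Suc j))" by (simp only: power_add power_Suc)
  obtain q where "Suc v = m ^ (i - 1) * q" using assms(1) by (auto simp: mod_eq_0_iff_dvd)
  then have "Suc v = m ^ (j - 1) * (m * m ^ (i - Suc j) * q)" unfolding e by (simp only: mult.assoc)
  then have "Suc v div m ^ (j - 1) = m * m ^ (i - Suc j) * q"
    using assms(4) by simp
  then show ?thesis by (simp add: digit_def)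
qed

lemma digit_Suc_above:
  assumes "Suc v mod m ^ i \<noteq> 0" "i < j"
  shows "digit m (Suc v) j = digit m v j"
proof -
  have "m ^ i dvd m ^ (j - 1)" using assms(2) by (intro le_imp_power_dvd) auto
  then have "Suc v mod m ^ (j - 1) \<noteq> 0" using assms(1) by (meson dvd_trans mod_0_imp_dvd dvd_imp_mod_0)
  then show ?thesis unfolding digit_def by (simp add: div_Suc)
qed

definition incr :: "nat \<Rightarrow> com" where
  "incr x = Assign x (Add (Var x) (Num 1))"

section \<open>The program\<close>

text \<open>Register 2 holds the number \<open>m\<close> of coloured vertices, register 3 is 1 iff no
  monochromatic edge has been found. Array 1 holds \<open>m\<close> followed by an odometer running
  through \<open>{1..m}\<^sup>k\<^sup>-\<^sup>1\<close>.\<close>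

definition reset_tuple :: com where
  "reset_tuple = Seq (Assign 4 (Num 1))
    (While (Less (Var 4) (Var 1)) (Seq (Store 1 (Var 4) (Num 1)) (incr 4)))"

text \<open>Register 5 holds the answer to the query. Register 4 stays below \<open>k\<close> after
  the loop exactly if some vertex has a colour different from that of vertex
  \<open>m\<close>.\<close>

definition test_tuple :: com where
  "test_tuple = Seq (Query 5 1 (Num 0))
    (Cond (Equal (Var 5) (Num 1))
      (Seq (Assign 4 (Num 1))
        (Seq (While (Conj (Less (Var 4) (Var 1))
            (Equal (Load 0 (Load 1 (Var 4))) (Load 0 (Var 2)))) (incr 4))
          (Cond (Less (Var 4) (Var 1)) Skip (Assign 3 (Num 0)))))
      Skip)"

text \<open>Register 7 is the overflow flag, raised when the carry leaves the last position.\<close>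

definition next_tuple :: com where
  "next_tuple = Seq (Assign 4 (Num 1))
    (Seq (While (Conj (Less (Var 4) (Var 1)) (Equal (Load 1 (Var 4)) (Var 2)))
        (Seq (Store 1 (Var 4) (Num 1)) (incr 4)))
      (Cond (Less (Var 4) (Var 1)) (Store 1 (Var 4) (Add (Load 1 (Var 4)) (Num 1))) (Assign 7 (Num 1))))"

definition check :: com where
  "check = Seq (Assign 3 (Num 1)) (Seq (Store 1 (Num 0) (Var 2)) (Seq reset_tuple (Seq (Assign 7 (Num 0))
    (While (Equal (Var 7) (Num 0)) (Seq test_tuple next_tuple)))))"

text \<open>Array 1 may change except at position 0, where \<open>m\<close> is kept. All other
  arrays, in particular the colours in array 0, must survive.\<close>

definition frame :: "nat set \<Rightarrow> state \<Rightarrow> state \<Rightarrow> bool" where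
  "frame R s s' \<longleftrightarrow> (\<forall>x. x \<notin> R \<longrightarrow> reg s' x = reg s x) \<and> (\<forall>A. A \<noteq> 1 \<longrightarrow> arr s' A = arr s A)
     \<and> arr s' 1 0 = arr s 1 0"

definition same_colour :: "(nat \<Rightarrow> nat) \<Rightarrow> nat \<Rightarrow> nat set \<Rightarrow> bool" where
  "same_colour f m e \<longleftrightarrow> (\<forall>x\<in>e. f x = f m)"

definition holds_tuple :: "nat \<Rightarrow> nat \<Rightarrow> nat \<Rightarrow> state \<Rightarrow> bool" where
  "holds_tuple k m v s \<longleftrightarrow> (\<forall>i\<in>{1..<k}. arr s 1 i = digit m v i)"

section \<open>Correctness and cost of checking one new colour\<close>

lemma wp_reset_tuple:
  assumes "reg s 1 = k" "k \<ge> 1" "m \<ge> 1"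
  shows "wp k E reset_tuple (20 * k) (\<lambda>s'. frame {4} s s' \<and> holds_tuple k m 0 s') s"
proof -
  note a = assms[simplified]
  \<comment> \<open>The variant \<open>i\<close> is the number of positions left, written as
    \<open>reg s' 4 + i = k\<close> to avoid truncated subtraction. Position 0 is skipped, so it
    starts at \<open>k - 1\<close>.\<close>
  define I where "I = (\<lambda>(i::nat) (s'::state). frame {4} s s' \<and> reg s' 4 + i = k \<and> reg s' 4 \<ge> 1 \<and>
    (\<forall>j\<in>{1..<reg s' 4}. arr s' 1 j = 1))"
  show ?thesis unfolding reset_tuple_def incr_def
    apply (rule wp_Seq[where t=2 and u="20 * k - 2"])
     apply (rule wp_Assign)
      apply (rule wp_While[where I=I and i="k - 1" and B=7])
         apply (simp add: I_def frame_def a)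
        apply (rule wp_Seq[where t=3 and u=4])
         apply (rule wp_Store)
          apply (rule wp_Assign)
           apply (rule_tac x="i - 1" in exI)
           apply (auto simp: I_def frame_def a less_Suc_eq)[1]
          apply simp
         apply simp
        apply simp
       apply (auto simp: I_def frame_def holds_tuple_def digit_def a)[1]
    using assms(2) by simp_all
qed

lemma wp_test_tuple:
  assumes "reg s 1 = k" "k \<ge> 1" "reg s 2 = m" "arr s 1 0 = m" "holds_tuple k m v s"
  shows "wp k E test_tuple (30 * k + 20) (\<lambda>s'. frame {3,4,5} s s' \<and> arr s' = arr s \<and>
    reg s' 3 = (if tuple_set k m v \<in> E \<and> same_colour (arr s 0) m (tuple_set k m v)
      then 0 else reg s 3)) s"
proof -
  note a = assms[simplified]
  define I where "I = (\<lambda>(i::nat) (s'::state). frame {4,5} s s' \<and> arr s' = arr s \<and> reg s' 4 + i = k \<and> reg s' 4 \<ge> 1 \<and>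
    (\<forall>j\<in>{1..<reg s' 4}. arr s 0 (arr s 1 j) = arr s 0 m))"
  have "{..<k} = insert 0 {1..<k}" using assms(2) by auto
  moreover have "arr s 1 ` {1..<k} = digit m v ` {1..<k}"
    using assms(5) by (intro image_cong) (auto simp: holds_tuple_def)
  ultimately have q: "(\<lambda>i. arr s 1 i) ` {..<k} = tuple_set k m v"
    using assms(4) by (simp only: tuple_set_def image_insert)
  have mono: "same_colour (arr s 0) m (tuple_set k m v) \<longleftrightarrow>
      (\<forall>j\<in>{1..<k}. arr s 0 (arr s 1 j) = arr s 0 m)"
    using assms(5) unfolding same_colour_def tuple_set_def holds_tuple_def by simp
  have exit: "\<not> (tuple_set k m v \<in> E \<and> same_colour (arr s 0) m (tuple_set k m v))"
    if "I i s'" "reg s' 4 < k" "arr s 0 (arr s 1 (reg s' 4)) \<noteq> arr s 0 m" for i s'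
  proof -
    have "reg s' 4 \<in> {1..<k}" using that(1,2) unfolding I_def atLeastLessThan_iff by blast
    then show ?thesis using that(3) unfolding mono by blast
  qed
  have step: "\<exists>j<i. I j (s'\<lparr>reg := (reg s')(4 := reg s' 4 + 1)\<rparr>)"
    if "I i s'" "reg s' 4 < k" "arr s 0 (arr s 1 (reg s' 4)) = arr s 0 m" for i s'
  proof (intro exI conjI)
    let ?s = "s'\<lparr>reg := (reg s')(4 := reg s' 4 + 1)\<rparr>"
    have "reg s' 4 + i = k" using that(1) by (simp add: I_def)
    then show "i - 1 < i" using that(2) by linarith
    have "arr s 0 (arr s 1 j) = arr s 0 m" if "j \<in> {1..<reg s' 4 + 1}" for j
    proof (cases "j = reg s' 4")
      case False
      then have "j \<in> {1..<reg s' 4}" using that by auto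
      then show ?thesis using \<open>I i s'\<close> unfolding I_def by blast
    qed (use \<open>arr s 0 (arr s 1 (reg s' 4)) = arr s 0 m\<close> in simp)
    then have "\<forall>j\<in>{1..<reg ?s 4}. arr s 0 (arr s 1 j) = arr s 0 m" by simp
    moreover have "frame {4,5} s ?s" "arr ?s = arr s" using that(1) by (simp_all add: I_def frame_def)
    moreover have "reg ?s 4 + (i - 1) = k" "reg ?s 4 \<ge> 1" using \<open>reg s' 4 + i = k\<close> that(2) by simp_all
    ultimately show "I (i - 1) ?s" unfolding I_def by blast
  qed
  have fin: "same_colour (arr s 0) m (tuple_set k m v)" if "I i s'" "\<not> reg s' 4 < k" for i s'
  proof -
    have "reg s' 4 = k" using that by (auto simp: I_def)
    then show ?thesis using that unfolding mono I_def by blast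
  qed
  have regs: "reg s' 1 = k" "reg s' 2 = m" "arr s' = arr s" if "I i s'" for i s'
    using that assms(1,3) by (simp_all add: I_def frame_def)
  have "(if arr s 1 ` {..<k} \<in> E then 1 else 0) = (1::nat) \<longleftrightarrow> tuple_set k m v \<in> E"
    using q by simp
  then have tin: "bval (Equal (Var 5) (Num 1)) (s\<lparr>reg := (reg s)(5 :=
      if (\<lambda>i. arr s 1 (aval (Num 0) s + i)) ` {..<k} \<in> E then 1 else 0)\<rparr>) \<longleftrightarrow> tuple_set k m v \<in> E"
    by simp
  have fr: "frame {4,5} s s'" "arr s' = arr s" if "I i s'" for i s'
    using that unfolding I_def by blast+
  have post_Skip: "frame {3,4,5} s s' \<and> arr s' = arr s \<and> reg s' 3 = reg s 3" if "I i s'" for i s'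
    using fr[OF that] by (simp add: frame_def)
  have post_bad: "frame {3,4,5} s (s'\<lparr>reg := (reg s')(3 := 0)\<rparr>) \<and> arr s' = arr s" if "I i s'" for i s'
    using fr[OF that] by (simp add: frame_def)
  show ?thesis unfolding test_tuple_def incr_def
    apply (rule wp_Seq[where t=2 and u="30 * k + 18"])
      apply (rule wp_Query)
       apply (rule wp_Cond[where t="30 * k + 14"])
         apply (rule wp_Seq[where t=2 and u="30 * k + 12"])
           apply (rule wp_Assign)
            apply (rule wp_Seq[where t="30 * k" and u=12])
             apply (rule wp_While[where I=I and i="k - 1" and B=4])
                apply (simp add: I_def frame_def a)
               apply (rule wp_Assign)
                apply (frule step)
                  apply (simp only: bval.simps aval.simps regs)
                 apply (simp only: bval.simps aval.simps regs)
                apply (simp only: aval.simps)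
               apply simp
              apply (rule wp_Cond[where t=2])
                apply (rule wp_Skip)
                 apply (frule exit)
                   apply (simp only: bval.simps aval.simps regs)
                  apply (simp only: bval.simps aval.simps regs simp_thms)
                 apply (simp only: if_False simp_thms post_Skip)
                apply simp
               apply (rule wp_Assign)
                apply (frule fin)
                 apply (simp only: bval.simps aval.simps regs simp_thms)
                apply (frule post_bad)
                apply (simp only: tin simp_thms if_True)
                apply simp
               apply simp
              apply simp
    using assms(2) apply simp
            apply simp
           apply simp
          apply simp
         apply (rule wp_Skip)
          apply (simp only: tin simp_thms if_False)
          apply (simp add: frame_def)
         apply simp
        apply simp
       apply simp
      apply simp
    done
qed

text \<open>The loop propagates the carry. It runs off the last position only if
  \<open>m ^ (k - 1)\<close> divides \<open>Suc v\<close>, that is, after the last tuple.\<close>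

lemma wp_next_tuple:
  assumes "reg s 1 = k" "k \<ge> 1" "reg s 2 = m" "m \<ge> 1" "holds_tuple k m v s" "v < m ^ (k - 1)"
  shows "wp k E next_tuple (30 * k + 20) (\<lambda>s'. frame {4,7} s s' \<and>
    (if Suc v < m ^ (k - 1) then reg s' 7 = reg s 7 \<and> holds_tuple k m (Suc v) s' else reg s' 7 = 1)) s"
proof -
  note a = assms[simplified]
  \<comment> \<open>The carry has reached the current position, everything below is already reset,
    and the rest still shows \<open>v\<close>.\<close>
  define I where "I = (\<lambda>(i::nat) (s'::state). frame {4} s s' \<and> reg s' 4 + i = k \<and> reg s' 4 \<ge> 1 \<and>
    Suc v mod m ^ (reg s' 4 - 1) = 0 \<and>
    (\<forall>j\<in>{1..<reg s' 4}. arr s' 1 j = 1) \<and> (\<forall>j\<in>{reg s' 4..<k}. arr s' 1 j = digit m v j))"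
  have step: "\<exists>j<i. I j (s'\<lparr>arr := (arr s')(1 := (arr s' 1)(reg s' 4 := 1)),
      reg := (reg s')(4 := reg s' 4 + 1)\<rparr>)"
    if "I i s'" "reg s' 4 < k" "arr s' 1 (reg s' 4) = m" for i s'
  proof -
    have "Suc v mod m ^ reg s' 4 = 0"
      using that digit_carry(1)[of v m "reg s' 4"] assms(4) unfolding I_def by auto
    then show ?thesis using that
      by (intro exI[of _ "i - 1"]) (auto simp: I_def frame_def less_Suc_eq)
  qed
  have exit1: "Suc v < m ^ (k - 1) \<and> holds_tuple k m (Suc v)
      (s'\<lparr>arr := (arr s')(1 := (arr s' 1)(reg s' 4 := Suc (arr s' 1 (reg s' 4))))\<rparr>)"
    if "I i s'" "reg s' 4 < k" "arr s' 1 (reg s' 4) \<noteq> m" for i s'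
  proof -
    let ?i = "reg s' 4"
    have i: "Suc v mod m ^ (?i - 1) = 0" "1 \<le> ?i" "digit m v ?i \<noteq> m"
      using that unfolding I_def by auto
    then have nz: "Suc v mod m ^ ?i \<noteq> 0" using digit_carry(1)[OF i(1,2) assms(4)] by blast
    have "m ^ ?i dvd m ^ (k - 1)" using that(2) by (intro le_imp_power_dvd) auto
    then have "Suc v \<noteq> m ^ (k - 1)" using nz by (metis dvd_imp_mod_0)
    moreover have "arr (s'\<lparr>arr := (arr s')(1 := (arr s' 1)(?i := Suc (arr s' 1 ?i)))\<rparr>) 1 j = digit m (Suc v) j"
      if "j \<in> {1..<k}" for j
    proof -
      consider "j < ?i" | "j = ?i" | "j > ?i" by linarith
      then show ?thesis
      proof cases
        case 1
        then show ?thesis using \<open>I i s'\<close> that digit_Suc_below[OF i(1) _ _ assms(4), of j] by (auto simp: I_def)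
      next
        case 2
        then show ?thesis using \<open>I i s'\<close> that digit_carry(2)[OF i(1,2) assms(4) i(3)] by (auto simp: I_def)
      next
        case 3
        then show ?thesis using \<open>I i s'\<close> that digit_Suc_above[OF nz, of j] by (auto simp: I_def)
      qed
    qed
    ultimately show ?thesis using assms(6) by (auto simp: holds_tuple_def)
  qed
  have exit2: "\<not> Suc v < m ^ (k - 1)" if "I i s'" "\<not> reg s' 4 < k" for i s'
  proof -
    have "reg s' 4 = k" using that by (auto simp: I_def)
    then have "Suc v mod m ^ (k - 1) = 0" using that by (auto simp: I_def)
    then show ?thesis by auto
  qed
  show ?thesis unfolding next_tuple_def incr_def
    apply (rule wp_Seq[where t=2 and u="30 * k + 18"])
     apply (rule wp_Assign)
      apply (rule wp_Seq[where t="30 * k" and u=18])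
       apply (rule wp_While[where I=I and i="k - 1" and B=7])
          apply (insert assms)[1]
          apply (simp add: I_def frame_def holds_tuple_def)
         apply (rule wp_Seq[where t=3 and u=4])
          apply (rule wp_Store)
           apply (rule wp_Assign)
            apply (frule step)
              apply (simp add: I_def frame_def a)
             apply (simp add: I_def frame_def a)
            apply simp
           apply simp
          apply simp
         apply simp
        apply (rule wp_Cond[where t=6])
          apply (rule wp_Store)
           apply (frule exit1)
             apply (simp add: I_def frame_def a)
            apply (simp add: I_def frame_def a)
           apply (simp add: I_def frame_def a)
          apply simp
         apply (rule wp_Assign)
          apply (frule exit2)
           apply (simp add: I_def frame_def a)
          apply (simp add: I_def frame_def a)
    using assms(2) by simp_all
qed

definition check_cost :: "nat \<Rightarrow> nat \<Rightarrow> nat" where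
  "check_cost k m = 20 * k + 50 + m ^ (k - 1) * (60 * k + 50)"

lemma wp_check:
  assumes "reg s 1 = k" "k \<ge> 1" "reg s 2 = m" "m \<ge> 1"
  shows "wp k E check (check_cost k m) (\<lambda>s'. (\<forall>x<3. reg s' x = reg s x) \<and> arr s' 0 = arr s 0 \<and>
    reg s' 3 = (if \<exists>v<m ^ (k - 1). tuple_set k m v \<in> E \<and> same_colour (arr s 0) m (tuple_set k m v)
      then 0 else 1)) s"
proof -
  note a = assms[simplified]
  define bad where "bad = (\<lambda>v. tuple_set k m v \<in> E \<and> same_colour (arr s 0) m (tuple_set k m v))"
  define N where "N = m ^ (k - 1)"
  define F where "F = (\<lambda>s'::state. (\<forall>x<3. reg s' x = reg s x) \<and> arr s' 0 = arr s 0 \<and> arr s' 1 0 = m)"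
  \<comment> \<open>The index \<open>i\<close> counts the tuples still to be tested, number
    \<open>N - i\<close> being the current one. The flag in register 7 is raised exactly when none
    is left.\<close>
  define I where "I = (\<lambda>(i::nat) (s'::state). F s' \<and>
     (if i = 0 then reg s' 7 = 1 else reg s' 7 = 0 \<and> i \<le> N \<and> holds_tuple k m (N - i) s') \<and>
     reg s' 3 = (if \<exists>v<N - i. bad v then 0 else 1))"
  have N: "N \<ge> 1" using assms(4) by (simp add: N_def)
  have step: "wp k E (Seq test_tuple next_tuple) (60 * k + 40) (\<lambda>s'. \<exists>j<i. I j s') s1"
    if "I i s1" "reg s1 7 = 0" for i s1
  proof -
    have i: "0 < i" "i \<le> N" "holds_tuple k m (N - i) s1" "F s1"
      "reg s1 3 = (if \<exists>v<N - i. bad v then 0 else 1)"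
      using that by (auto simp: I_def split: if_splits)
    have b: "(tuple_set k m (N - i) \<in> E \<and> same_colour (arr s1 0) m (tuple_set k m (N - i))) = bad (N - i)"
      using i(4) by (auto simp: bad_def F_def)
    have Si: "Suc (N - i) = N - (i - 1)" using i by auto
    have ex: "(\<exists>v<N - (i - 1). bad v) \<longleftrightarrow> bad (N - i) \<or> (\<exists>v<N - i. bad v)"
      unfolding Si[symmetric] by (auto simp: less_Suc_eq)
    show ?thesis
    proof (rule wp_Seq[where t="30 * k + 20" and u="30 * k + 20"])
      show "wp k E test_tuple (30 * k + 20) (wp k E next_tuple (30 * k + 20) (\<lambda>s'. \<exists>j<i. I j s')) s1"
      proof (rule wp_mono[OF wp_test_tuple[where k=k and m=m and v="N - i"] order_refl])
        fix s2 assume s2: "frame {3, 4, 5} s1 s2 \<and> arr s2 = arr s1 \<and>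
          reg s2 3 = (if tuple_set k m (N - i) \<in> E \<and> same_colour (arr s1 0) m (tuple_set k m (N - i))
            then 0 else reg s1 3)"
        show "wp k E next_tuple (30 * k + 20) (\<lambda>s'. \<exists>j<i. I j s') s2"
        proof (rule wp_mono[OF wp_next_tuple[where k=k and m=m and v="N - i"] order_refl])
          fix s3 assume s3: "frame {4, 7} s2 s3 \<and>
            (if Suc (N - i) < m ^ (k - 1) then reg s3 7 = reg s2 7 \<and> holds_tuple k m (Suc (N - i)) s3
             else reg s3 7 = 1)"
          have "F s3" using s2 s3 i(4) by (auto simp: F_def frame_def)
          moreover have "reg s3 3 = (if \<exists>v<N - (i - 1). bad v then 0 else 1)"
            using s2 s3 i(5) unfolding b ex by (auto simp: frame_def)
          moreover have "if i - 1 = 0 then reg s3 7 = 1 else reg s3 7 = 0 \<and> i - 1 \<le> N \<and> holds_tuple k m (N - (i - 1)) s3"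
            using s2 s3 i(1,2) that(2) unfolding N_def[symmetric] Si by (auto simp: frame_def split: if_splits)
          ultimately have "I (i - 1) s3" unfolding I_def by blast
          then show "\<exists>j<i. I j s3" using i(1) by (intro exI[of _ "i - 1"]) auto
        qed (use s2 i assms in \<open>auto simp: frame_def F_def holds_tuple_def N_def\<close>)
      qed (use i assms in \<open>auto simp: F_def\<close>)
    qed auto
  qed
  have loop: "wp k E (While (Equal (Var 7) (Num 0)) (Seq test_tuple next_tuple)) (N * (60 * k + 50) + 40)
     (I 0) s1" if "I N s1" for s1
  proof (rule wp_While[where I=I and i=N and B="60 * k + 40"])
    show "I 0 s'" if "I i s'" "\<not> bval (Equal (Var 7) (Num 0)) s'" for i s'
      using that by (auto simp: I_def split: if_splits)
    show "N * (1 + bcost (Equal (Var 7) (Num 0)) + (60 * k + 40)) + 1 + bcost (Equal (Var 7) (Num 0))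
      \<le> N * (60 * k + 50) + 40"
      by (simp add: algebra_simps)
  qed (use that step in auto)
  show ?thesis unfolding check_def check_cost_def
    apply (rule wp_Seq[where t=2 and u="20 * k + 48 + m ^ (k - 1) * (60 * k + 50)"])
     apply (rule wp_Assign)
      apply (rule wp_Seq[where t=3 and u="20 * k + 45 + m ^ (k - 1) * (60 * k + 50)"])
       apply (rule wp_Store)
        apply (rule wp_Seq[where t="20 * k" and u="45 + m ^ (k - 1) * (60 * k + 50)"])
         apply (rule wp_mono[OF wp_reset_tuple[where m=m] order_refl])
            apply (simp add: a)
           apply (rule assms)
          apply (rule assms)
         apply (rule wp_Seq[where t=2 and u="43 + m ^ (k - 1) * (60 * k + 50)"])
          apply (rule wp_Assign)
           apply (rule wp_mono[OF loop])
             apply (insert N assms)[1]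
             apply (simp add: I_def F_def frame_def holds_tuple_def)
            apply (simp add: N_def)
           apply (simp add: I_def F_def bad_def N_def)
    by simp_all
qed

section \<open>Proper colourings of initial segments\<close>

text \<open>A colouring is represented by one of its classes, so that a colouring and its complement count
  separately.\<close>

definition mono_sets :: "nat \<Rightarrow> nat \<Rightarrow> nat set \<Rightarrow> nat set set" where
  "mono_sets k m c = {e \<in> nsets {1..m} k. e \<subseteq> c \<or> e \<inter> c = {}}"

definition colourings :: "nat \<Rightarrow> nat \<Rightarrow> nat set set \<Rightarrow> nat set set" where
  "colourings k m E = {c \<in> Pow {1..m}. E \<inter> mono_sets k m c = {}}"

lemma finite_colourings: "finite (colourings k m E)"
  by (simp add: colourings_def)

text \<open>This makes pruning safe: below a partial colouring that is not proper there is no proper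
  colouring.\<close>

lemma colourings_restrict:
  assumes "c \<in> colourings k n E" "m \<le> n"
  shows "c \<inter> {1..m} \<in> colourings k m E"
proof -
  have "mono_sets k m (c \<inter> {1..m}) \<subseteq> mono_sets k n c"
    using assms(2) unfolding mono_sets_def nsets_def by fastforce
  then show ?thesis using assms(1) unfolding colourings_def by blast
qed

text \<open>Edges within \<open>{1..m}\<close> were dealt with on earlier levels, so only those with
  maximum \<open>Suc m\<close> matter. This keeps a check at order \<open>m ^ (k - 1)\<close> rather
  than \<open>m ^ k\<close>.\<close>

lemma colourings_Suc_iff:
  assumes "c \<subseteq> {1..Suc m}"
  shows "c \<in> colourings k (Suc m) E \<longleftrightarrow> c \<inter> {1..m} \<in> colourings k m E \<and>
    \<not> (\<exists>e\<in>E. e \<in> nsets {1..Suc m} k \<and> Suc m \<in> e \<and> (e \<subseteq> c \<or> e \<inter> c = {}))"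
proof -
  have "mono_sets k (Suc m) c = mono_sets k m (c \<inter> {1..m}) \<union>
    {e \<in> nsets {1..Suc m} k. Suc m \<in> e \<and> (e \<subseteq> c \<or> e \<inter> c = {})}" (is "?L = ?R")
  proof
    show "?L \<subseteq> ?R"
    proof
      fix e assume "e \<in> ?L"
      moreover have "e \<subseteq> {1..m}" if "e \<subseteq> {1..Suc m}" "Suc m \<notin> e"
        using that by (auto simp: subset_iff le_Suc_eq)
      ultimately show "e \<in> ?R" unfolding mono_sets_def nsets_def by blast
    qed
    have "{1..m} \<subseteq> {1..Suc m}" by auto
    then show "?R \<subseteq> ?L" unfolding mono_sets_def nsets_def by blast
  qed
  then show ?thesis using assms unfolding colourings_def by blast
qed

section \<open>The backtracking search and its cost\<close>

definition represents :: "nat \<Rightarrow> nat \<Rightarrow> nat \<Rightarrow> nat set \<Rightarrow> bool \<Rightarrow> state \<Rightarrow> bool" where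
  "represents k n m c ok s \<longleftrightarrow> reg s 0 = n \<and> reg s 1 = k \<and> reg s 2 = m \<and>
    reg s 3 = (if ok then 1 else 0) \<and> (\<forall>v\<in>{1..m}. arr s 0 v = (if v \<in> c then 1 else 0))"

text \<open>Depth-first search without a stack: since 0 is tried before 1, the colour of the current
  vertex tells which alternatives remain. After success the search descends with colour 0; after
  failure it flips 0 to 1, or steps back from 1 with the failure flag kept.\<close>

definition step :: com where
  "step = Cond (Equal (Var 3) (Num 1))
     (Seq (incr 2) (Seq (Store 0 (Var 2) (Num 0)) check))
     (Cond (Equal (Load 0 (Var 2)) (Num 0))
       (Seq (Store 0 (Var 2) (Num 1)) check)
       (Seq (Assign 2 (Sub (Var 2) (Num 1))) (Assign 3 (Num 0))))"

definition search :: com where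
  "search = While (Neg (Conj (Equal (Var 3) (Num 1)) (Equal (Var 2) (Var 0)))) step"

definition prog :: com where
  "prog = Seq (Assign 3 (Num 1)) search"

text \<open>This lemma and the next two execute one round of the loop, one for each case of
  \<open>step\<close>, with the rest of the search as postcondition. The constants 40, 40 and 30
  absorb tests and assignments.\<close>

lemma search_push:
  assumes "reg s 3 = 1" "reg s 2 = m" "reg s 2 \<noteq> reg s 0"
    and "wp k E check t (wp k E search u Q)
      (s\<lparr>reg := (reg s)(2 := Suc m), arr := (arr s)(0 := (arr s 0)(Suc m := 0))\<rparr>)"
    and "t + u + 40 \<le> v"
  shows "wp k E search v Q s"
proof -
  have "wp k E step (t + 20) (wp k E search u Q) s"
    unfolding step_def incr_def
  proof (rule wp_Cond[where t="t + 10"], goal_cases)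
    case 1
    show ?case
      by (rule wp_Seq[where t=4 and u="t + 4"], rule wp_Assign,
          rule wp_Seq[where t=4 and u=t], rule wp_Store) (use assms in simp_all)
  qed (use assms in auto)
  then show ?thesis unfolding search_def by (rule wp_While_True[rotated]) (use assms in auto)
qed

lemma search_flip:
  assumes "reg s 3 = 0" "reg s 2 = m" "arr s 0 m = 0"
    and "wp k E check t (wp k E search u Q) (s\<lparr>arr := (arr s)(0 := (arr s 0)(m := 1))\<rparr>)"
    and "t + u + 40 \<le> v"
  shows "wp k E search v Q s"
proof -
  have "wp k E step (t + 20) (wp k E search u Q) s"
    unfolding step_def
  proof (rule wp_Cond[where t="t + 15"], goal_cases)
    case 2
    show ?case
    proof (rule wp_Cond[where t="t + 5"], goal_cases)
      case 1
      show ?case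
        by (rule wp_Seq[where t=4 and u=t], rule wp_Store) (use assms in simp_all)
    qed (use assms in auto)
  qed (use assms in auto)
  then show ?thesis unfolding search_def by (rule wp_While_True[rotated]) (use assms in auto)
qed

lemma search_pop:
  assumes "reg s 3 = 0" "reg s 2 = Suc m" "arr s 0 (Suc m) = 1"
    and "wp k E search u Q (s\<lparr>reg := (reg s)(2 := m, 3 := 0)\<rparr>)"
    and "u + 30 \<le> v"
  shows "wp k E search v Q s"
proof -
  have "wp k E step 20 (wp k E search u Q) s"
    unfolding step_def
  proof (rule wp_Cond[where t=15], goal_cases)
    case 2
    show ?case
    proof (rule wp_Cond[where t=8], goal_cases)
      case 2
      show ?case
        by (rule wp_Seq[where t=4 and u=2], rule wp_Assign, rule wp_Assign) (use assms in simp_all)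
    qed (use assms in auto)
  qed (use assms in auto)
  then show ?thesis unfolding search_def by (rule wp_While_True[rotated]) (use assms in auto)
qed

text \<open>The check inspects only \<open>k\<close>-sets with maximum \<open>Suc m\<close>. By
  \<open>colourings_Suc_iff\<close> this decides properness because the restriction to
  \<open>{1..m}\<close> is assumed proper.\<close>

lemma wp_check_represents:
  assumes s: "represents k n (Suc m) c ok s" and c: "c \<subseteq> {1..Suc m}"
    and "c \<inter> {1..m} \<in> colourings k m E" and E: "E \<subseteq> nsets {1..n} k" and "k \<ge> 1" "Suc m \<le> n"
  shows "wp k E check (check_cost k (Suc m))
    (represents k n (Suc m) c (c \<in> colourings k (Suc m) E)) s"
proof (rule wp_mono[OF wp_check[of s k "Suc m" E] order_refl])
  fix s' :: state
  let ?B = "\<lambda>v. tuple_set k (Suc m) v \<in> E \<and> same_colour (arr s 0) (Suc m) (tuple_set k (Suc m) v)"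
  assume s': "(\<forall>x<3. reg s' x = reg s x) \<and> arr s' 0 = arr s 0 \<and>
    reg s' 3 = (if \<exists>v<Suc m ^ (k - 1). ?B v then 0 else 1)"
  have col: "same_colour (arr s 0) (Suc m) e \<longleftrightarrow> e \<subseteq> c \<or> e \<inter> c = {}"
    if "e \<subseteq> {1..Suc m}" "Suc m \<in> e" for e
  proof -
    have "arr s 0 x = arr s 0 (Suc m) \<longleftrightarrow> (x \<in> c \<longleftrightarrow> Suc m \<in> c)" if "x \<in> e" for x
    proof -
      have "x \<in> {1..Suc m}" using that \<open>e \<subseteq> {1..Suc m}\<close> by blast
      then have "arr s 0 x = (if x \<in> c then 1 else 0)" using s unfolding represents_def by blast
      moreover have "arr s 0 (Suc m) = (if Suc m \<in> c then 1 else 0)" using s unfolding represents_def by simp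
      ultimately show ?thesis by simp
    qed
    then have "same_colour (arr s 0) (Suc m) e \<longleftrightarrow> (\<forall>x\<in>e. x \<in> c \<longleftrightarrow> Suc m \<in> c)"
      unfolding same_colour_def by blast
    also have "\<dots> \<longleftrightarrow> e \<subseteq> c \<or> e \<inter> c = {}" using that(2) by blast
    finally show ?thesis .
  qed
  have "(\<exists>v<Suc m ^ (k - 1). ?B v) \<longleftrightarrow>
     (\<exists>e\<in>E. same_colour (arr s 0) (Suc m) e \<and> (\<exists>v<Suc m ^ (k - 1). tuple_set k (Suc m) v = e))"
    by blast
  also have "\<dots> \<longleftrightarrow> (\<exists>e\<in>E. same_colour (arr s 0) (Suc m) e \<and> e \<subseteq> {1..Suc m} \<and> Suc m \<in> e)"
  proof (rule bex_cong[OF refl], rule conj_cong[OF refl])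
    fix e assume "e \<in> E"
    then have "card e = k" using E by (auto simp: nsets_def)
    then show "(\<exists>v<Suc m ^ (k - 1). tuple_set k (Suc m) v = e) \<longleftrightarrow> e \<subseteq> {1..Suc m} \<and> Suc m \<in> e"
      using tuple_set_iff[of "Suc m" k e] \<open>k \<ge> 1\<close> by simp
  qed
  also have "\<dots> \<longleftrightarrow> (\<exists>e\<in>E. e \<in> nsets {1..Suc m} k \<and> Suc m \<in> e \<and> (e \<subseteq> c \<or> e \<inter> c = {}))"
    using E col unfolding nsets_def by blast
  finally have "(\<exists>v<Suc m ^ (k - 1). ?B v) \<longleftrightarrow> c \<notin> colourings k (Suc m) E"
    using colourings_Suc_iff[OF c, of k E] assms(3) by blast
  then have "reg s' 3 = (if c \<in> colourings k (Suc m) E then 1 else 0)" using s' by simp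
  moreover have "arr s' 0 = arr s 0" "reg s' 0 = n" "reg s' 1 = k" "reg s' 2 = Suc m"
    using s s' by (simp_all add: represents_def)
  ultimately show "represents k n (Suc m) c (c \<in> colourings k (Suc m) E) s'"
    using s unfolding represents_def by simp
qed (use s assms in \<open>simp_all add: represents_def\<close>)

text \<open>\<open>node_cost k m\<close> pays for checking both level-\<open>m\<close> children of a node and for returning to it.\<close>

definition node_cost :: "nat \<Rightarrow> nat \<Rightarrow> nat" where
  "node_cost k m = 2 * check_cost k m + 110"

text \<open>Both children are charged even if the search succeeds in the first one, so this is an
  upper bound. A node that fails its check costs nothing itself: the check is paid by the
  parent.\<close>

fun subtree_cost :: "nat \<Rightarrow> nat set set \<Rightarrow> nat \<Rightarrow> nat \<Rightarrow> nat set \<Rightarrow> nat" where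
  "subtree_cost k E 0 m c = 0"
| "subtree_cost k E (Suc d) m c = (if c \<in> colourings k m E then
     node_cost k (Suc m) + subtree_cost k E d (Suc m) c + subtree_cost k E d (Suc m) (insert (Suc m) c) else 0)"

definition found :: "nat \<Rightarrow> nat set set \<Rightarrow> nat \<Rightarrow> state \<Rightarrow> bool" where
  "found k E n s \<longleftrightarrow> (\<exists>c \<in> colourings k n E. represents k n n c True s)"

lemma restrict_Suc:
  assumes "d \<inter> {1..m} = c"
  shows "d \<inter> {1..Suc m} = c \<or> d \<inter> {1..Suc m} = insert (Suc m) c"
proof -
  have "{1..Suc m} = insert (Suc m) {1..m}" by auto
  then show ?thesis using assms by (simp add: Int_insert_right)
qed

text \<open>Continuation style: whatever the search does after giving up on the subtree below \<open>c\<close> is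
  summarised by the budget \<open>B\<close>, and it gives up only if \<open>c\<close> has no proper extension.\<close>

lemma wp_search:
  assumes "m + d = n" "c \<subseteq> {1..m}" "represents k n m c (c \<in> colourings k m E) s"
    and "E \<subseteq> nsets {1..n} k" "k \<ge> 1" "B \<ge> 20"
    and "\<not> (\<exists>x \<in> colourings k n E. x \<inter> {1..m} = c) \<Longrightarrow>
      (\<And>s'. represents k n m c False s' \<Longrightarrow> wp k E search B (found k E n) s')"
  shows "wp k E search (subtree_cost k E d m c + B) (found k E n) s"
  using assms(1-3,6,7)
proof (induction d arbitrary: m c s B)
  case 0
  show ?case
  proof (cases "c \<in> colourings k m E")
    case True
    then have "represents k n n c True s" "c \<in> colourings k n E" using 0(1,3) by simp_all
    then have "found k E n s" "reg s 3 = 1" "reg s 2 = reg s 0"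
      unfolding found_def represents_def by auto
    then show ?thesis unfolding search_def using 0(4) by (intro wp_While_False) simp_all
  next
    case False
    have "x \<inter> {1..m} \<in> colourings k m E" if "x \<in> colourings k n E" for x
      using colourings_restrict[OF that] 0(1) by simp
    then have "\<not> (\<exists>x \<in> colourings k n E. x \<inter> {1..m} = c)" using False by blast
    moreover have "represents k n m c False s" using 0(3) False by simp
    ultimately have "wp k E search B (found k E n) s" by (rule 0(5))
    then show ?thesis by simp
  qed
next
  case (Suc d)
  show ?case
  proof (cases "c \<in> colourings k m E")
    case False
    have "x \<inter> {1..m} \<in> colourings k m E" if "x \<in> colourings k n E" for x
      using colourings_restrict[OF that] Suc.prems(1) by simp
    then have "\<not> (\<exists>x \<in> colourings k n E. x \<inter> {1..m} = c)" using False by blast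
    moreover have "represents k n m c False s" using Suc.prems(3) False by simp
    ultimately have "wp k E search B (found k E n) s" by (rule Suc.prems(5))
    then show ?thesis using False by simp
  next
    case True
    let ?c = "insert (Suc m) c"
    let ?m = "Suc m"
    let ?K = "check_cost k ?m"
    have notin: "Suc m \<notin> c" using Suc.prems(2) by auto
    have c1: "c \<subseteq> {1..?m}" "?c \<subseteq> {1..?m}" using Suc.prems(2) by auto
    have c2: "c \<inter> {1..m} = c" "?c \<inter> {1..m} = c" using Suc.prems(2) by auto
    have le: "Suc m \<le> n" using Suc.prems(1) by linarith
    have pop: "wp k E search (B + 30) (found k E n) s'"
      if "represents k n ?m ?c False s'" "\<not> (\<exists>x \<in> colourings k n E. x \<inter> {1..m} = c)" for s'
    proof -
      have r: "reg s' 3 = 0" "reg s' 2 = ?m" "arr s' 0 ?m = 1" "reg s' 0 = n"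
        using that(1) unfolding represents_def by auto
      have "represents k n m c False (s'\<lparr>reg := (reg s')(2 := m, 3 := 0)\<rparr>)"
        using that(1) notin unfolding represents_def by auto
      from Suc.prems(5)[OF that(2) this]
      show ?thesis by (rule search_pop[OF r(1-3)]) simp
    qed
    \<comment> \<open>Here colour 0 of the new vertex has been given up. The budget covers the flip,
      the second check, the subtree with colour 1 and a possible return.\<close>
    have right: "wp k E search (subtree_cost k E d ?m ?c + ?K + B + 70) (found k E n) s'"
      if "represents k n ?m c False s'" "\<not> (\<exists>x \<in> colourings k n E. x \<inter> {1..?m} = c)" for s'
    proof -
      have r: "reg s' 3 = 0" "reg s' 2 = ?m" "arr s' 0 ?m = 0"
        using that(1) notin unfolding represents_def by auto
      let ?s = "s'\<lparr>arr := (arr s')(0 := (arr s' 0)(?m := 1))\<rparr>"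
      have rep: "represents k n ?m ?c False ?s"
        using that(1) unfolding represents_def by auto
      have *: "wp k E search (subtree_cost k E d ?m ?c + (B + 30)) (found k E n) s2"
        if "represents k n ?m ?c (?c \<in> colourings k ?m E) s2" for s2
      proof (rule Suc.IH[OF _ c1(2) that])
        fix s3 assume "\<not> (\<exists>x \<in> colourings k n E. x \<inter> {1..?m} = ?c)" "represents k n ?m ?c False s3"
        \<comment> \<open>A proper extension of \<open>c\<close> would extend one of the two
          children, and both have been excluded.\<close>
        moreover from this(1) have "\<not> (\<exists>x \<in> colourings k n E. x \<inter> {1..m} = c)"
          using restrict_Suc[of _ m c] \<open>\<not> (\<exists>x \<in> colourings k n E. x \<inter> {1..?m} = c)\<close> by meson
        ultimately show "wp k E search (B + 30) (found k E n) s3" by (intro pop)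
      qed (use Suc.prems(1,4) in simp_all)
      have chk: "wp k E check ?K (wp k E search (subtree_cost k E d ?m ?c + (B + 30)) (found k E n)) ?s"
        by (rule wp_mono[OF wp_check_represents[OF rep c1(2) _ assms(4,5) le] order_refl *])
          (simp only: c2 True)
      show ?thesis by (rule search_flip[OF r chk]) simp
    qed
    have r: "reg s 3 = 1" "reg s 2 = m" "reg s 0 = n"
      using Suc.prems(3) True unfolding represents_def by auto
    let ?s = "s\<lparr>reg := (reg s)(2 := ?m), arr := (arr s)(0 := (arr s 0)(?m := 0))\<rparr>"
    have rep: "represents k n ?m c True ?s"
      using Suc.prems(3) True notin unfolding represents_def by auto
    \<comment> \<open>This is the continuation budget of the first child: all that may follow once
      it is given up.\<close>
    let ?B = "subtree_cost k E d ?m ?c + ?K + B + 70"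
    have *: "wp k E search (subtree_cost k E d ?m c + ?B) (found k E n) s2"
      if "represents k n ?m c (c \<in> colourings k ?m E) s2" for s2
      by (rule Suc.IH[OF _ c1(1) that _ right]) (use Suc.prems(1,4) in simp_all)
    have chk: "wp k E check ?K (wp k E search (subtree_cost k E d ?m c + ?B) (found k E n)) ?s"
      by (rule wp_mono[OF wp_check_represents[OF rep c1(1) _ assms(4,5) le] order_refl *])
        (simp only: c2 True)
    have "reg s 2 \<noteq> reg s 0" using r Suc.prems(1) by linarith
    \<comment> \<open>The overheads 40, 40 and 30 of push, flip and pop add up to the 110 in
      \<open>node_cost\<close>.\<close>
    then show ?thesis
      by (rule search_push[OF r(1,2) _ chk]) (use True in \<open>simp add: node_cost_def\<close>)
  qed
qed

text \<open>All children of the proper colourings on one level are distinct, and improper ones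
  contribute nothing. So the recursive costs sum to at most those of the proper colourings on the
  next level.\<close>

lemma sum_subtree_cost:
  "(\<Sum>c\<in>colourings k m E. subtree_cost k E d m c) \<le>
     (\<Sum>i<d. node_cost k (Suc (m + i)) * card (colourings k (m + i) E))"
proof (induction d arbitrary: m)
  case (Suc d)
  let ?V = "colourings k m E" and ?T = "subtree_cost k E d (Suc m)"
  have notin: "Suc m \<notin> c" if "c \<in> ?V" for c using that unfolding colourings_def by auto
  have inj: "inj_on (insert (Suc m)) ?V" using notin by (auto simp: inj_on_def dest: insert_ident)
  have disj: "?V \<inter> insert (Suc m) ` ?V = {}" using notin by auto
  have zero: "?T c = 0" if "c \<notin> colourings k (Suc m) E" for c using that by (cases d) auto
  have "(\<Sum>c\<in>?V. ?T c) + (\<Sum>c\<in>?V. ?T (insert (Suc m) c)) = (\<Sum>c\<in>?V \<union> insert (Suc m) ` ?V. ?T c)"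
    using inj disj by (simp add: sum.union_disjoint sum.reindex finite_colourings)
  also have "\<dots> = (\<Sum>c\<in>(?V \<union> insert (Suc m) ` ?V) \<inter> colourings k (Suc m) E. ?T c)"
    by (intro sum.mono_neutral_right ballI zero) (auto simp: finite_colourings)
  also have "\<dots> \<le> (\<Sum>c\<in>colourings k (Suc m) E. ?T c)"
    by (intro sum_mono2) (auto simp: finite_colourings)
  also have "\<dots> \<le> (\<Sum>i<d. node_cost k (Suc (Suc m + i)) * card (colourings k (Suc m + i) E))"
    by (rule Suc.IH)
  finally have "(\<Sum>c\<in>?V. ?T c) + (\<Sum>c\<in>?V. ?T (insert (Suc m) c)) \<le> \<dots>" .
  moreover have "(\<Sum>c\<in>?V. subtree_cost k E (Suc d) m c) =
      node_cost k (Suc m) * card ?V + ((\<Sum>c\<in>?V. ?T c) + (\<Sum>c\<in>?V. ?T (insert (Suc m) c)))"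
    by (simp add: sum.distrib)
  ultimately show ?case unfolding sum.lessThan_Suc_shift by simp
qed simp

lemma wp_prog:
  assumes "E \<subseteq> nsets {1..n} k" "k \<ge> 1" "colourings k n E \<noteq> {}"
  shows "wp k E prog (30 + (\<Sum>m<n. node_cost k (Suc m) * card (colourings k m E))) (found k E n)
    (init_state k n)"
proof -
  have c0: "colourings k 0 E = {{}}"
    using assms(1,2) by (auto simp: colourings_def mono_sets_def nsets_def)
  have "wp k E search (subtree_cost k E n 0 {} + 20) (found k E n) ((init_state k n)\<lparr>reg := (reg (init_state k n))(3 := 1)\<rparr>)"
  \<comment> \<open>Giving up at the root is impossible: a proper colouring exists, and every set
    restricts to the empty one on \<open>{1..0}\<close>. Hence the minimal budget 20 suffices for
    \<open>B\<close>.\<close>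
  proof (rule wp_search)
    show "represents k n 0 {} ({} \<in> colourings k 0 E) ((init_state k n)\<lparr>reg := (reg (init_state k n))(3 := 1)\<rparr>)"
      by (simp add: c0 represents_def init_state_def)
  qed (use assms in auto)
  moreover have "subtree_cost k E n 0 {} \<le> (\<Sum>m<n. node_cost k (Suc m) * card (colourings k m E))"
    using sum_subtree_cost[where k=k and E=E and m=0 and d=n] by (simp add: c0)
  ultimately have "wp k E search (28 + (\<Sum>m<n. node_cost k (Suc m) * card (colourings k m E))) (found k E n)
    ((init_state k n)\<lparr>reg := (reg (init_state k n))(3 := 1)\<rparr>)"
    by (elim wp_mono) auto
  then show ?thesis unfolding prog_def by (intro wp_Seq[where t=2] wp_Assign) auto
qed

section \<open>From proper colourings to bipartitions\<close>

lemma bipartition_iff_colouring: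
  assumes "fst H = {1..n}" "kgraph k H"
  shows "bipartition H c ({1..n} - c) \<longleftrightarrow> c \<in> colourings k n (snd H)"
proof -
  have "e \<notin> mono_sets k n c \<longleftrightarrow> e \<inter> c \<noteq> {} \<and> e \<inter> ({1..n} - c) \<noteq> {}" if "e \<in> snd H" for e
  proof -
    have "e \<in> nsets {1..n} k" using assms that unfolding kgraph_def by auto
    moreover from this have "e \<inter> ({1..n} - c) = e - c" by (auto simp: nsets_def)
    ultimately show ?thesis by (auto simp: mono_sets_def)
  qed
  then have "snd H \<inter> mono_sets k n c = {} \<longleftrightarrow>
      (\<forall>e\<in>snd H. e \<inter> c \<noteq> {} \<and> e \<inter> ({1..n} - c) \<noteq> {})"
    by (simp only: disjoint_iff Ball_def cong: imp_cong)
  moreover have "c \<union> ({1..n} - c) = {1..n} \<longleftrightarrow> c \<subseteq> {1..n}" by auto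
  ultimately show ?thesis
    unfolding bipartition_def colourings_def assms(1) by simp
qed

lemma bipartition_commute: "bipartition H X Y \<longleftrightarrow> bipartition H Y X"
  unfolding bipartition_def by (simp only: Un_commute Int_commute conj_commute)

lemma bipartite_iff_colourings:
  assumes "fst H = {1..n}" "kgraph k H"
  shows "bipartite H \<longleftrightarrow> colourings k n (snd H) \<noteq> {}"
proof
  assume "bipartite H"
  then obtain X Y where XY: "bipartition H X Y" unfolding bipartite_def by auto
  then have "Y = {1..n} - X" using assms(1) unfolding bipartition_def by auto
  then show "colourings k n (snd H) \<noteq> {}"
    using XY bipartition_iff_colouring[OF assms, of X] by auto
next
  assume "colourings k n (snd H) \<noteq> {}"
  then show "bipartite H"
    unfolding bipartite_def using bipartition_iff_colouring[OF assms] by auto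
qed

lemma found_bipartition:
  assumes "fst H = {1..n}" "kgraph k H" "found k (snd H) n s"
  shows "bipartition H (colour_X H s) (colour_Y H s)"
proof -
  obtain c where c: "c \<in> colourings k n (snd H)" "represents k n n c True s"
    using assms(3) unfolding found_def by blast
  have a: "arr s 0 v = (if v \<in> c then 1 else 0)" if "v \<in> {1..n}" for v
    using c(2) that unfolding represents_def by blast
  have "colour_X H s = {1..n} - c" "colour_Y H s = c"
    using c(1) assms(1) by (auto simp: colour_X_def colour_Y_def colourings_def a)
  then show ?thesis
    using c(1)[folded bipartition_iff_colouring[OF assms(1,2)]] by (simp add: bipartition_commute)
qed

lemma prog_correct:
  assumes "k \<ge> 1" "H \<in> bip_class k n"
  shows "\<exists>t s. run prog k H t s \<and> bipartition H (colour_X H s) (colour_Y H s)"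
    and "running_time prog k H \<le> 30 + (\<Sum>m<n. node_cost k (Suc m) * card (colourings k m (snd H)))"
proof -
  let ?B = "30 + (\<Sum>m<n. node_cost k (Suc m) * card (colourings k m (snd H)))"
  have H: "fst H = {1..n}" "kgraph k H" "bipartite H" using assms(2) by (auto simp: bip_class_def)
  then have "wp k (snd H) prog ?B (found k (snd H) n) (init_state k n)"
    using bipartite_iff_colourings[OF H(1,2)] assms(1)
    by (intro wp_prog) (auto simp: kgraph_def)
  then obtain t s where ts: "run prog k H t s" "t \<le> ?B" "found k (snd H) n s"
    unfolding wp_def run_def using H(1) by auto
  then show "\<exists>t s. run prog k H t s \<and> bipartition H (colour_X H s) (colour_Y H s)"
    using found_bipartition[OF H(1,2)] by blast
  have "running_time prog k H = t"
    unfolding running_time_def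
  proof (rule the_equality)
    show "\<exists>s. run prog k H t s" using ts(1) by blast
    show "u = t" if "\<exists>s. run prog k H u s" for u
      using that ts(1) exec_deterministic unfolding run_def by blast
  qed
  then show "running_time prog k H \<le> ?B" using ts(2) by simp
qed

section \<open>Weights of colourings\<close>

text \<open>Convexity of \<open>n choose k\<close> in \<open>n\<close>: raising \<open>n\<close> by
  one adds \<open>n choose (k - 1)\<close>, which is monotone in \<open>n\<close>.\<close>

lemma choose_spread:
  fixes a b x k :: nat
  assumes "a \<le> b"
  shows "(a + x choose k) + (b choose k) \<le> (a choose k) + (b + x choose k)"
proof (induction x)
  case (Suc x)
  show ?case
  proof (cases k)
    case (Suc j)
    have "(a + x choose j) \<le> (b + x choose j)" using assms by (intro binomial_right_mono) simp
    then show ?thesis using Suc.IH Suc by simp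
  qed simp
qed simp

text \<open>The index \<open>l - j\<close> is at least as far from the centre \<open>r / 2\<close>
  as \<open>j\<close> is, and binomial coefficients decrease away from the centre.\<close>

lemma choose_far_le:
  fixes r l j :: nat
  assumes "2 * j \<le> l" "r \<le> l"
  shows "(r choose (l - j)) \<le> (r choose j)"
proof -
  consider "l - j > r" | "l - j \<le> r" "r \<le> 2 * j" | "l - j \<le> r" "2 * j < r" by linarith
  then show ?thesis
  proof cases
    case 2
    then show ?thesis using assms by (intro binomial_antimono) auto
  next
    case 3
    have "(r choose (l - j)) \<le> (r choose (r - j))"
      using 3 assms by (intro binomial_antimono) auto
    then show ?thesis using 3 by (simp add: binomial_symmetric[of j r])
  qed (simp add: binomial_eq_0)
qed

lemma sum_Pow_Un:
  assumes "A \<inter> B = {}"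
  shows "(\<Sum>X\<in>Pow (A \<union> B). f X) = (\<Sum>P\<in>Pow A. \<Sum>Q\<in>Pow B. f (P \<union> Q))"
proof -
  have "(\<Sum>X\<in>Pow (A \<union> B). f X) = (\<Sum>(P, Q)\<in>Pow A \<times> Pow B. f (P \<union> Q))"
    using assms
    by (intro sum.reindex_bij_witness[where i="\<lambda>(P, Q). P \<union> Q" and j="\<lambda>X. (X \<inter> A, X \<inter> B)"])
      (auto simp: Int_absorb2 simp flip: Int_Un_distrib)
  then show ?thesis by (simp add: sum.cartesian_product)
qed

lemma sum_Pow_card:
  fixes g :: "nat \<Rightarrow> real"
  assumes "finite S"
  shows "(\<Sum>c\<in>Pow S. g (card c)) = (\<Sum>j\<le>card S. real (card S choose j) * g j)"
proof -
  have "(\<Sum>c\<in>Pow S. g (card c)) = (\<Sum>j\<le>card S. \<Sum>c\<in>{c. c \<in> Pow S \<and> card c = j}. g (card c))"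
    using assms by (intro sum.group[symmetric]) (auto intro: card_mono)
  also have "\<dots> = (\<Sum>j\<le>card S. real (card S choose j) * g j)"
  proof (rule sum.cong[OF refl])
    fix j
    have "card {c. c \<in> Pow S \<and> card c = j} = (card S choose j)"
      using n_subsets[OF assms, of j] by simp
    then show "(\<Sum>c\<in>{c. c \<in> Pow S \<and> card c = j}. g (card c)) = real (card S choose j) * g j"
      by simp
  qed
  finally show ?thesis .
qed

lemma sum_Pow_power:
  fixes x :: real
  assumes "finite S"
  shows "(\<Sum>c\<in>Pow S. x ^ card c) = (1 + x) ^ card S"
  using sum_Pow_card[OF assms, of "\<lambda>j. x ^ j"] binomial_ring[of x 1 "card S"] by (simp add: add.commute)

lemma sum_Pow_power_compl:
  fixes x :: real
  assumes "finite S"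
  shows "(\<Sum>c\<in>Pow S. x ^ card (S - c)) = (1 + x) ^ card S"
proof -
  have "(\<Sum>c\<in>Pow S. x ^ card (S - c)) = (\<Sum>c\<in>Pow S. x ^ card c)"
    by (intro sum.reindex_bij_witness[where i="\<lambda>c. S - c" and j="\<lambda>c. S - c"]) auto
  then show ?thesis using sum_Pow_power[OF assms] by simp
qed

text \<open>Up to a common factor, the number of graphs for which a given colouring with a class of size
  \<open>j\<close> is proper.\<close>

definition weight :: "nat \<Rightarrow> nat \<Rightarrow> nat \<Rightarrow> real" where
  "weight k n j = (1 / 2) ^ ((j choose k) + (n - j choose k))"

lemma weight_pos: "weight k n j > 0"
  by (simp add: weight_def)

lemma weight_sym: "j \<le> n \<Longrightarrow> weight k n (n - j) = weight k n j"
  by (simp add: weight_def add.commute)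

text \<open>The assumption says that \<open>i + j\<close> is no farther from \<open>n / 2\<close>
  than \<open>j\<close>. By convexity, more balanced classes contain fewer monochromatic
  \<open>k\<close>-sets.\<close>

lemma weight_mono:
  assumes "2 * j + i \<le> n"
  shows "weight k n j \<le> weight k n (i + j)"
proof -
  have "(j + i choose k) + (n - (i + j) choose k) \<le> (j choose k) + (n - (i + j) + i choose k)"
    using assms by (intro choose_spread) auto
  moreover have "n - (i + j) + i = n - j" using assms by auto
  ultimately show ?thesis unfolding weight_def
    by (intro power_decreasing) (auto simp: add.commute)
qed

lemma weight_le_middle:
  assumes "j \<le> n"
  shows "weight k n j \<le> weight k n (n div 2)"
proof -
  have *: "weight k n j \<le> weight k n (n div 2)" if "j \<le> n div 2" for j
    using weight_mono[of j "n div 2 - j" n k] that by auto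
  show ?thesis
  proof (cases "j \<le> n div 2")
    case False
    then have "n - j \<le> n div 2" by auto
    from *[OF this] show ?thesis using weight_sym[OF assms] by simp
  qed (rule *)
qed

text \<open>Reversing the order of summation pairs the terms so that both differences have the same sign.\<close>

lemma shifted_weight_ge:
  assumes "i + r \<le> n"
  shows "(\<Sum>j\<le>r. real (r choose j) * weight k n j) \<le> (\<Sum>j\<le>r. real (r choose j) * weight k n (i + j))"
proof -
  define l where "l = n - i"
  have l: "r \<le> l" "l \<le> n" "n - l = i" using assms by (auto simp: l_def)
  define D where "D = (\<lambda>j. weight k n (i + j) - weight k n j)"
  \<comment> \<open>Terms beyond \<open>r\<close> vanish. Summing up to \<open>l\<close> makes the
    range symmetric under reversal, and the symmetry of \<open>weight\<close> makes \<open>D\<close>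
    antisymmetric.\<close>
  define S where "S = (\<Sum>j\<le>l. real (r choose j) * D j)"
  have D: "D (l - j) = - D j" if "j \<le> l" for j
  proof -
    have "i + (l - j) = n - j" "l - j = n - (i + j)" using that l assms by (auto simp: l_def)
    moreover have "i + j \<le> n" using that l assms by (auto simp: l_def)
    ultimately show ?thesis using that l weight_sym[of j n k] weight_sym[of "i + j" n k] unfolding D_def by simp
  qed
  have D0: "D j \<ge> 0" if "2 * j \<le> l" for j
    using weight_mono[of j i n k] that l assms unfolding D_def l_def by auto
  have "S = (\<Sum>j\<le>l. real (r choose (l - j)) * D (l - j))"
    unfolding S_def by (rule sum.reindex_bij_witness[where i="\<lambda>j. l - j" and j="\<lambda>j. l - j"]) auto
  also have "\<dots> = - (\<Sum>j\<le>l. real (r choose (l - j)) * D j)"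
    by (simp add: D flip: sum_negf)
  finally have "2 * S = (\<Sum>j\<le>l. (real (r choose j) - real (r choose (l - j))) * D j)"
    unfolding S_def by (simp add: left_diff_distrib sum_subtractf)
  also have "\<dots> \<ge> 0"
  proof (rule sum_nonneg)
    fix j assume j: "j \<in> {..l}"
    show "0 \<le> (real (r choose j) - real (r choose (l - j))) * D j"
    proof (cases "2 * j \<le> l")
      case True
      then show ?thesis using choose_far_le[OF True l(1)] D0 by (intro mult_nonneg_nonneg) auto
    next
      case False
      then have "2 * (l - j) \<le> l" using j by auto
      then show ?thesis using choose_far_le[OF _ l(1), of "l - j"] D0[of "l - j"] D[of j] j
        by (intro mult_nonpos_nonpos) auto
    qed
  qed
  finally have "S \<ge> 0" by simp
  moreover have "S = (\<Sum>j\<le>r. real (r choose j) * D j)"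
    unfolding S_def using l(1) by (intro sum.mono_neutral_right) (auto simp: binomial_eq_0)
  ultimately show ?thesis unfolding D_def by (simp add: right_diff_distrib sum_subtractf)
qed

lemma sum_weight_sym:
  "(\<Sum>j\<le>r. real (r choose j) * weight k (m + r) (m + j)) = (\<Sum>j\<le>r. real (r choose j) * weight k (m + r) j)"
proof (rule sum.reindex_bij_witness[where i="\<lambda>j. r - j" and j="\<lambda>j. r - j"])
  fix j assume "j \<in> {..r}"
  then show "real (r choose (r - j)) * weight k (m + r) (r - j) = real (r choose j) * weight k (m + r) (m + j)"
    using weight_sym[of "m + j" "m + r" k] by (simp add: binomial_symmetric[symmetric])
qed auto

definition total_weight :: "nat \<Rightarrow> nat \<Rightarrow> real" where
  "total_weight k n = (\<Sum>X\<in>Pow {1..n}. weight k n (card X))"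

lemma total_weight_pos: "total_weight k n > 0"
  unfolding total_weight_def by (intro sum_pos) (auto simp: weight_pos)

lemma Pow_split: "m \<le> n \<Longrightarrow> {1..n} = {1..m} \<union> {Suc m..n} \<and> {1..m} \<inter> {Suc m..n} = {}" for m n :: nat
  by auto

text \<open>Colourings are sorted by their trace \<open>A\<close> on \<open>{1..m}\<close>. The
  inner sum is the weight of all extensions of \<open>A\<close>, with \<open>j\<close> counting the
  later vertices that join its class.\<close>

lemma sum_weight_split:
  fixes f :: "nat set \<Rightarrow> real"
  assumes "m \<le> n"
  shows "(\<Sum>X\<in>Pow {1..n}. weight k n (card X) * f (X \<inter> {1..m})) =
    (\<Sum>A\<in>Pow {1..m}. f A * (\<Sum>j\<le>n - m. real (n - m choose j) * weight k n (card A + j)))"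
proof -
  let ?R = "{Suc m..n}"
  have n: "{1..n} = {1..m} \<union> ?R" "{1..m} \<inter> ?R = {}" using Pow_split[OF assms] by auto
  have "(\<Sum>X\<in>Pow {1..n}. weight k n (card X) * f (X \<inter> {1..m})) =
      (\<Sum>A\<in>Pow {1..m}. \<Sum>B\<in>Pow ?R. weight k n (card (A \<union> B)) * f ((A \<union> B) \<inter> {1..m}))"
    unfolding n(1) by (rule sum_Pow_Un[OF n(2)])
  also have "\<dots> = (\<Sum>A\<in>Pow {1..m}. f A * (\<Sum>B\<in>Pow ?R. weight k n (card A + card B)))"
    unfolding sum_distrib_left
  proof (intro sum.cong refl)
    fix A B assume AB: "A \<in> Pow {1..m}" "B \<in> Pow ?R"
    then have "A \<inter> B = {}" "(A \<union> B) \<inter> {1..m} = A" using n(2) by blast+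
    moreover have "finite A" "finite B" using AB by (auto intro: finite_subset)
    ultimately show "weight k n (card (A \<union> B)) * f ((A \<union> B) \<inter> {1..m}) = f A * weight k n (card A + card B)"
      by (simp add: card_Un_disjoint)
  qed
  also have "\<dots> = (\<Sum>A\<in>Pow {1..m}. f A * (\<Sum>j\<le>n - m. real (n - m choose j) * weight k n (card A + j)))"
  proof (intro sum.cong refl)
    fix A
    show "f A * (\<Sum>B\<in>Pow ?R. weight k n (card A + card B)) =
      f A * (\<Sum>j\<le>n - m. real (n - m choose j) * weight k n (card A + j))"
      using sum_Pow_card[of ?R "\<lambda>j. weight k n (card A + j)"] assms by (simp add: Suc_diff_le)
  qed
  finally show ?thesis .
qed

lemma total_weight_split:
  assumes "m \<le> n"
  shows "total_weight k n =
    (\<Sum>A\<in>Pow {1..m}. \<Sum>j\<le>n - m. real (n - m choose j) * weight k n (card A + j))"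
  using sum_weight_split[OF assms, of k "\<lambda>_. 1"] by (simp add: total_weight_def)

text \<open>A constant trace has the least extension weight: by \<open>shifted_weight_ge\<close>
  each of the \<open>2 ^ m\<close> traces has at least as much. The full trace has the same
  extension weight as the empty one by symmetry.\<close>

lemma trivial_restriction_weight:
  assumes "m \<le> n" "A = {} \<or> A = {1..m}"
  shows "2 ^ m * (\<Sum>j\<le>n - m. real (n - m choose j) * weight k n (card A + j)) \<le> total_weight k n"
proof -
  have "(\<Sum>j\<le>n - m. real (n - m choose j) * weight k n (card A + j)) =
      (\<Sum>j\<le>n - m. real (n - m choose j) * weight k n j)"
    using assms sum_weight_sym[of "n - m" k m] by auto
  then have "2 ^ m * (\<Sum>j\<le>n - m. real (n - m choose j) * weight k n (card A + j)) =
      (\<Sum>A\<in>Pow {1..m}. \<Sum>j\<le>n - m. real (n - m choose j) * weight k n j)"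
    by (simp add: card_Pow)
  also have "\<dots> \<le> total_weight k n"
    unfolding total_weight_split[OF assms(1)]
  proof (rule sum_mono)
    fix A assume "A \<in> Pow {1..m}"
    then have "card A \<le> m" using card_mono[of "{1..m}" A] by auto
    then show "(\<Sum>j\<le>n - m. real (n - m choose j) * weight k n j) \<le>
        (\<Sum>j\<le>n - m. real (n - m choose j) * weight k n (card A + j))"
      using assms(1) by (intro shifted_weight_ge) linarith
  qed
  finally show ?thesis .
qed

text \<open>A crude bound for arbitrary traces, losing a factor \<open>n + 1\<close>: every weight
  is at most the middle one, and the middle layer alone contains at least a fraction
  \<open>1 / (n + 1)\<close> of all subsets.\<close>

lemma restriction_weight_le:
  assumes "m \<le> n" "A \<subseteq> {1..m}"
  shows "2 ^ m * (\<Sum>j\<le>n - m. real (n - m choose j) * weight k n (card A + j)) \<le> (real n + 1) * total_weight k n"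
proof -
  let ?w = "weight k n (n div 2)"
  have A: "card A \<le> m" using card_mono[of "{1..m}" A] assms(2) by auto
  have "(\<Sum>j\<le>n - m. real (n - m choose j) * weight k n (card A + j)) \<le> (\<Sum>j\<le>n - m. real (n - m choose j) * ?w)"
    using A assms(1) by (intro sum_mono mult_left_mono weight_le_middle) auto
  also have "\<dots> = 2 ^ (n - m) * ?w"
    using choose_row_sum[of "n - m"] by (simp flip: sum_distrib_right of_nat_sum)
  finally have "2 ^ m * (\<Sum>j\<le>n - m. real (n - m choose j) * weight k n (card A + j)) \<le> 2 ^ m * (2 ^ (n - m) * ?w)"
    by (intro mult_left_mono) auto
  also have "\<dots> = 2 ^ n * ?w" using assms(1) by (simp flip: power_add mult.assoc)
  also have "\<dots> \<le> (real n + 1) * real (n choose (n div 2)) * ?w"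
  proof (rule mult_right_mono)
    have "(2::real) ^ n = (\<Sum>j\<le>n. real (n choose j))"
      using choose_row_sum[of n] by (simp flip: of_nat_sum)
    also have "\<dots> \<le> (\<Sum>j\<le>n. real (n choose (n div 2)))"
      by (intro sum_mono) (simp add: binomial_maximum)
    finally show "2 ^ n \<le> (real n + 1) * real (n choose (n div 2))" by (simp add: add.commute)
  qed (simp add: weight_pos less_imp_le)
  also have "\<dots> = (real n + 1) * (real (n choose (n div 2)) * ?w)" by simp
  also have "\<dots> \<le> (real n + 1) * total_weight k n"
  proof (rule mult_left_mono)
    have "real (n choose (n div 2)) * ?w \<le> (\<Sum>j\<le>n. real (n choose j) * weight k n j)"
      by (rule member_le_sum) (auto simp: weight_pos less_imp_le)
    also have "\<dots> = total_weight k n"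
      unfolding total_weight_def using sum_Pow_card[of "{1..n}" "weight k n"] by simp
    finally show "real (n choose (n div 2)) * ?w \<le> total_weight k n" .
  qed simp
  finally show ?thesis .
qed

section \<open>The penalty for splitting a class\<close>

lemma choose_superlinear:
  assumes "j \<ge> 2" "s \<ge> 4 * j\<^sup>2"
  shows "2 * (s + 1) \<le> (s choose j)"
proof -
  have j2: "j\<^sup>2 \<ge> j" using assms(1) by (simp add: power2_eq_square)
  then have sj: "s \<ge> j" using assms(2) by linarith
  have "4 * real j ^ 2 \<le> real s" using assms(2) by (metis of_nat_le_iff of_nat_mult of_nat_numeral of_nat_power)
  then have "4 * real s * real j ^ 2 \<le> real s * real s"
    by (metis mult.commute mult.left_commute mult_left_mono of_nat_0_le_iff)
  then have "4 * real s \<le> (real s / real j) ^ 2"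
    using assms(1) by (simp add: power_divide pos_le_divide_eq power2_eq_square)
  also have "\<dots> \<le> (real s / real j) ^ j"
    using assms(1) sj by (intro power_increasing) auto
  also have "\<dots> \<le> real (s choose j)" by (rule binomial_ge_n_over_k_pow_k[OF sj])
  finally have "4 * real s \<le> real (s choose j)" .
  moreover have "s \<ge> 1" using sj assms(1) by linarith
  ultimately have "real (2 * (s + 1)) \<le> real (s choose j)" by simp
  then show ?thesis by (simp only: of_nat_le_iff)
qed

text \<open>Here \<open>k >= 3\<close> enters: it makes the exponent grow faster than linearly in
  \<open>t\<close>. The base 1/4 leaves a factor \<open>(1 / 2) ^ t\<close> after summing over the
  \<open>2 ^ t\<close> ways to split a class of size \<open>t\<close>.\<close>

lemma split_bound:
  assumes "k \<ge> 3"
  obtains K :: real where "K \<ge> 1" "\<And>t. (1 / 2) ^ (t - 1 choose (k - 1)) \<le> K * (1 / 4) ^ t"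
proof -
  \<comment> \<open>The \<open>+ 1\<close> is there because \<open>choose_superlinear\<close> is
    applied to \<open>t - 1\<close>. Below \<open>t0\<close> the left side is at most 1, while
    \<open>4 ^ t0 * (1 / 4) ^ t\<close> is at least 1.\<close>
  define t0 where "t0 = 4 * (k - 1)\<^sup>2 + 1"
  have "(1 / 2 :: real) ^ (t - 1 choose (k - 1)) \<le> 4 ^ t0 * (1 / 4) ^ t" for t
  proof (cases "t \<ge> t0")
    case True
    then have "2 * t \<le> (t - 1 choose (k - 1))"
      using choose_superlinear[of "k - 1" "t - 1"] assms by (auto simp: t0_def)
    then have "(1 / 2 :: real) ^ (t - 1 choose (k - 1)) \<le> (1 / 2) ^ (2 * t)"
      by (intro power_decreasing) auto
    also have "\<dots> = 1 * (1 / 4) ^ t" by (simp add: power_mult power_divide)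
    also have "\<dots> \<le> 4 ^ t0 * (1 / 4) ^ t" by (intro mult_right_mono) auto
    finally show ?thesis .
  next
    case False
    have "(1 / 2 :: real) ^ (t - 1 choose (k - 1)) \<le> 1" by (rule power_le_one) auto
    also have "(1::real) = 4 ^ t * (1 / 4) ^ t" by (simp flip: power_mult_distrib)
    also have "\<dots> \<le> 4 ^ t0 * (1 / 4) ^ t" using False by (intro mult_right_mono power_increasing) auto
    finally show ?thesis .
  qed
  then show ?thesis using that[of "4 ^ t0"] by simp
qed

text \<open>Here \<open>P\<close> is the part of the class \<open>c\<close> that the larger
  colouring \<open>X\<close> puts on one side. The cases of an unsplit and a split class get
  separate functions, so that the product over both classes of a colouring can be expanded.\<close>

definition trivial_split :: "'a set \<Rightarrow> 'a set \<Rightarrow> real" where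
  "trivial_split c P = (if P = {} \<or> P = c then 1 else 0)"

definition proper_split :: "real \<Rightarrow> 'a set \<Rightarrow> 'a set \<Rightarrow> real" where
  "proper_split K c P = (if P = {} \<or> P = c then 0 else K * (1 / 4) ^ card c)"

lemma sum_trivial_split:
  assumes "finite c"
  shows "(\<Sum>P\<in>Pow c. trivial_split c P) \<le> 2"
proof -
  have "(\<Sum>P\<in>Pow c. trivial_split c P) = (\<Sum>P\<in>{{}, c}. trivial_split c P)"
    using assms by (intro sum.mono_neutral_right) (auto simp: trivial_split_def)
  also have "\<dots> \<le> 2" by (cases "c = {}") (auto simp: trivial_split_def)
  finally show ?thesis .
qed

lemma sum_proper_split:
  assumes "finite c" "K \<ge> 0"
  shows "(\<Sum>P\<in>Pow c. proper_split K c P) \<le> K * (1 / 2) ^ card c"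
proof -
  have "(\<Sum>P\<in>Pow c. proper_split K c P) \<le> (\<Sum>P\<in>Pow c. K * (1 / 4) ^ card c)"
    using assms by (intro sum_mono) (auto simp: proper_split_def)
  also have "\<dots> = K * (2 ^ card c * (1 / 4) ^ card c)" using assms(1) by (simp add: card_Pow)
  also have "\<dots> = K * (1 / 2) ^ card c" by (simp flip: power_mult_distrib)
  finally show ?thesis .
qed

lemma splits_nonneg: "trivial_split c P \<ge> 0" "K \<ge> 0 \<Longrightarrow> proper_split K c P \<ge> 0"
  by (auto simp: trivial_split_def proper_split_def)

lemma trivial_split_le_1: "trivial_split c P \<le> 1"
  by (simp add: trivial_split_def)

text \<open>A subset of \<open>S\<close> amounts to an independent choice of its traces on
  \<open>c\<close> and \<open>S - c\<close>.\<close>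

lemma sum_Pow_product:
  fixes f g :: "'a set \<Rightarrow> real"
  assumes "c \<subseteq> S"
  shows "(\<Sum>A\<in>Pow S. f (A \<inter> c) * g (A \<inter> (S - c))) = (\<Sum>P\<in>Pow c. f P) * (\<Sum>Q\<in>Pow (S - c). g Q)"
proof -
  have S: "S = c \<union> (S - c)" using assms by blast
  have "(\<Sum>A\<in>Pow S. f (A \<inter> c) * g (A \<inter> (S - c))) =
      (\<Sum>A\<in>Pow (c \<union> (S - c)). f (A \<inter> c) * g (A \<inter> (S - c)))"
    using S by simp
  also have "\<dots> = (\<Sum>P\<in>Pow c. \<Sum>Q\<in>Pow (S - c). f ((P \<union> Q) \<inter> c) * g ((P \<union> Q) \<inter> (S - c)))"
    by (rule sum_Pow_Un) blast
  also have "\<dots> = (\<Sum>P\<in>Pow c. \<Sum>Q\<in>Pow (S - c). f P * g Q)"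
  proof (intro sum.cong refl)
    fix P Q assume "P \<in> Pow c" "Q \<in> Pow (S - c)"
    then have "(P \<union> Q) \<inter> c = P" "(P \<union> Q) \<inter> (S - c) = Q" by blast+
    then show "f ((P \<union> Q) \<inter> c) * g ((P \<union> Q) \<inter> (S - c)) = f P * g Q" by simp
  qed
  finally show ?thesis by (simp add: sum_product)
qed

text \<open>If \<open>A\<close> splits neither \<open>c\<close> nor \<open>S - c\<close>, it is a
  union of some of these two sets, which leaves four candidates.\<close>

lemma trivial_splits_le:
  assumes "c \<subseteq> S" "A \<subseteq> S"
  shows "trivial_split c (A \<inter> c) * trivial_split (S - c) (A \<inter> (S - c)) \<le>
    of_bool (A = c) + of_bool (A = S - c) + (of_bool (A = {}) + of_bool (A = S))"
proof (cases "(A \<inter> c = {} \<or> A \<inter> c = c) \<and> (A \<inter> (S - c) = {} \<or> A \<inter> (S - c) = S - c)")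
  case True
  have "A \<inter> c \<union> A \<inter> (S - c) \<in> {{} \<union> {}, {} \<union> (S - c), c \<union> {}, c \<union> (S - c)}"
    using True by (elim conjE disjE) simp_all
  moreover have "A \<inter> c \<union> A \<inter> (S - c) = A" "c \<union> (S - c) = S" using assms by blast+
  ultimately have "A = {} \<or> A = S - c \<or> A = c \<or> A = S" by simp
  then have "1 \<le> of_bool (A = c) + of_bool (A = S - c) + (of_bool (A = {}) + of_bool (A = S) :: real)"
    by (elim disjE) simp_all
  moreover have "trivial_split c (A \<inter> c) * trivial_split (S - c) (A \<inter> (S - c)) \<le> 1"
    by (intro mult_le_one splits_nonneg trivial_split_le_1)
  ultimately show ?thesis by linarith
next
  case False
  then have "trivial_split c (A \<inter> c) = 0 \<or> trivial_split (S - c) (A \<inter> (S - c)) = 0"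
    unfolding trivial_split_def de_Morgan_conj by (rule disj_forward) (rule if_not_P, assumption)+
  then show ?thesis by (elim disjE) simp_all
qed

text \<open>The expanded product over both classes, without the term in which neither is
  split.\<close>

definition nontrivial_part :: "real \<Rightarrow> 'a set \<Rightarrow> 'a set \<Rightarrow> 'a set \<Rightarrow> real" where
  "nontrivial_part K S c A =
     trivial_split c (A \<inter> c) * proper_split K (S - c) (A \<inter> (S - c)) +
     proper_split K c (A \<inter> c) * trivial_split (S - c) (A \<inter> (S - c)) +
     proper_split K c (A \<inter> c) * proper_split K (S - c) (A \<inter> (S - c))"

text \<open>For fixed \<open>c\<close> the sum over \<open>A\<close> factorises: an unsplit class
  gives at most 2, a split one at most \<open>K\<close> times a power of 1/2. Summing
  \<open>(1 / 2) ^ card c\<close> over all \<open>c\<close> then gives the power of 3/2.\<close>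

lemma sum_nontrivial_part:
  assumes "finite S" "K \<ge> 1"
  shows "(\<Sum>c\<in>Pow S. \<Sum>A\<in>Pow S. nontrivial_part K S c A) \<le> 5 * K\<^sup>2 * (3 / 2) ^ card S"
proof -
  have "(\<Sum>A\<in>Pow S. nontrivial_part K S c A) \<le>
      2 * K * (1 / 2) ^ card (S - c) + 2 * K * (1 / 2) ^ card c + K\<^sup>2 * (1 / 2) ^ card S"
    if "c \<in> Pow S" for c
  proof -
    have c: "c \<subseteq> S" "finite c" "finite (S - c)" using that assms(1) finite_subset by auto
    have cS: "card c + card (S - c) = card S"
      using c assms(1) by (simp add: card_Diff_subset card_mono)
    have K: "K \<ge> 0" using assms(2) by simp
    let ?t = "\<lambda>c. \<Sum>P\<in>Pow c. trivial_split c P" and ?p = "\<lambda>c. \<Sum>P\<in>Pow c. proper_split K c P"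
    have "(\<Sum>A\<in>Pow S. nontrivial_part K S c A) = ?t c * ?p (S - c) + ?p c * ?t (S - c) + ?p c * ?p (S - c)"
      unfolding nontrivial_part_def sum.distrib sum_Pow_product[OF c(1)] ..
    also have "\<dots> \<le> 2 * (K * (1 / 2) ^ card (S - c)) + (K * (1 / 2) ^ card c) * 2 +
        (K * (1 / 2) ^ card c) * (K * (1 / 2) ^ card (S - c))"
      using K c(2,3)
      by (intro add_mono mult_mono sum_trivial_split sum_proper_split)
        (auto intro!: sum_nonneg splits_nonneg)
    also have "\<dots> = 2 * K * (1 / 2) ^ card (S - c) + 2 * K * (1 / 2) ^ card c + K\<^sup>2 * (1 / 2) ^ card S"
      by (simp add: power2_eq_square power_add flip: cS)
    finally show ?thesis .
  qed
  then have "(\<Sum>c\<in>Pow S. \<Sum>A\<in>Pow S. nontrivial_part K S c A) \<le>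
      (\<Sum>c\<in>Pow S. 2 * K * (1 / 2) ^ card (S - c) + 2 * K * (1 / 2) ^ card c + K\<^sup>2 * (1 / 2) ^ card S)"
    by (rule sum_mono)
  also have "\<dots> = 4 * K * (3 / 2) ^ card S + K\<^sup>2"
  proof -
    have "(2::real) ^ card S * (1 / 2) ^ card S = 1" by (simp flip: power_mult_distrib)
    then show ?thesis
      using assms(1) sum_Pow_power[OF assms(1), of "1 / 2"] sum_Pow_power_compl[OF assms(1), of "1 / 2"]
      by (simp add: sum.distrib card_Pow flip: sum_distrib_left)
  qed
  also have "\<dots> \<le> 5 * K\<^sup>2 * (3 / 2) ^ card S"
  proof -
    have "K \<le> K\<^sup>2" using assms(2) by (simp add: power2_eq_square)
    then have "4 * K * (3 / 2) ^ card S + K\<^sup>2 * 1 \<le> 4 * K\<^sup>2 * (3 / 2) ^ card S + K\<^sup>2 * (3 / 2) ^ card S"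
      by (intro add_mono mult_right_mono mult_left_mono one_le_power) auto
    then show ?thesis by (simp add: distrib_right[symmetric])
  qed
  finally show ?thesis .
qed

lemma sum_of_bool_eq: "finite T \<Longrightarrow> x \<in> T \<Longrightarrow> (\<Sum>c\<in>T. of_bool (x = c)) = (1::real)"
  by (simp add: of_bool_def)

text \<open>Unsplit classes account for the 4: twice the total from traces equal to \<open>c\<close>
  or its complement, and once for each of the two constant traces. Otherwise the factor
  \<open>(3 / 2) ^ m\<close> of \<open>sum_nontrivial_part\<close> meets the factor
  \<open>(1 / 2) ^ m\<close> of \<open>restriction_weight_le\<close>.\<close>

lemma split_sum_le:
  assumes "m \<le> n" "K \<ge> 1"
  shows "(\<Sum>X\<in>Pow {1..n}. \<Sum>c\<in>Pow {1..m}. weight k n (card X) *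
      ((trivial_split c (X \<inter> c) + proper_split K c (X \<inter> c)) *
       (trivial_split ({1..m} - c) (X \<inter> ({1..m} - c)) + proper_split K ({1..m} - c) (X \<inter> ({1..m} - c)))))
    \<le> (4 + 5 * K\<^sup>2 * (real n + 1) * (3 / 4) ^ m) * total_weight k n"
proof -
  let ?M = "{1..m}"
  let ?w = "\<lambda>X. weight k n (card X)"
  define W where "W = (\<lambda>A :: nat set. \<Sum>j\<le>n - m. real (n - m choose j) * weight k n (card A + j))"
  let ?Z = "total_weight k n"
  \<comment> \<open>A trace agrees with exactly one \<open>c\<close> and with the complement of
    exactly one; for a constant trace all \<open>2 ^ m\<close> choices of \<open>c\<close> are
    counted.\<close>
  define tr where "tr = (\<lambda>A. 2 + 2 ^ m * (of_bool (A = {}) + of_bool (A = ?M)) :: real)"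
  define nt where "nt = (\<lambda>A. \<Sum>c\<in>Pow ?M. nontrivial_part K ?M c A)"
  have pt: "(\<Sum>c\<in>Pow ?M. (trivial_split c (X \<inter> c) + proper_split K c (X \<inter> c)) *
       (trivial_split (?M - c) (X \<inter> (?M - c)) + proper_split K (?M - c) (X \<inter> (?M - c))))
      \<le> tr (X \<inter> ?M) + nt (X \<inter> ?M)" for X
  proof -
    let ?A = "X \<inter> ?M"
    have "(\<Sum>c\<in>Pow ?M. (trivial_split c (X \<inter> c) + proper_split K c (X \<inter> c)) *
       (trivial_split (?M - c) (X \<inter> (?M - c)) + proper_split K (?M - c) (X \<inter> (?M - c)))) \<le>
       (\<Sum>c\<in>Pow ?M. (of_bool (?A = c) + of_bool (?M - ?A = c) + (of_bool (?A = {}) + of_bool (?A = ?M))) + nontrivial_part K ?M c ?A)"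
    proof (rule sum_mono)
      fix c assume "c \<in> Pow ?M"
      then have c: "c \<subseteq> ?M" "X \<inter> c = ?A \<inter> c" "X \<inter> (?M - c) = ?A \<inter> (?M - c)" by blast+
      have swap: "?A = ?M - c \<longleftrightarrow> ?M - ?A = c"
      proof
        assume "?M - ?A = c"
        then have "c = ?M - ?A" ..
        then show "?A = ?M - c" by auto
      qed (use c(1) in auto)
      show "(trivial_split c (X \<inter> c) + proper_split K c (X \<inter> c)) *
         (trivial_split (?M - c) (X \<inter> (?M - c)) + proper_split K (?M - c) (X \<inter> (?M - c))) \<le>
         (of_bool (?A = c) + of_bool (?M - ?A = c) + (of_bool (?A = {}) + of_bool (?A = ?M))) + nontrivial_part K ?M c ?A"
        using trivial_splits_le[OF c(1), of ?A] unfolding c(2,3) swap nontrivial_part_def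
        by (simp add: algebra_simps)
    qed
    also have "\<dots> = tr ?A + nt ?A"
    proof -
      have "(\<Sum>c\<in>Pow ?M. of_bool (?A = c)) = (1::real)" "(\<Sum>c\<in>Pow ?M. of_bool (?M - ?A = c)) = (1::real)"
        by (rule sum_of_bool_eq; blast)+
      then show ?thesis unfolding tr_def nt_def sum.distrib by (simp add: card_Pow)
    qed
    finally show ?thesis .
  qed
  have "(\<Sum>X\<in>Pow {1..n}. \<Sum>c\<in>Pow ?M. ?w X *
      ((trivial_split c (X \<inter> c) + proper_split K c (X \<inter> c)) *
       (trivial_split (?M - c) (X \<inter> (?M - c)) + proper_split K (?M - c) (X \<inter> (?M - c)))))
    \<le> (\<Sum>X\<in>Pow {1..n}. ?w X * (tr (X \<inter> ?M) + nt (X \<inter> ?M)))"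
    unfolding sum_distrib_left[symmetric]
    using pt by (intro sum_mono mult_left_mono) (auto simp: weight_pos less_imp_le)
  also have "\<dots> = (\<Sum>X\<in>Pow {1..n}. ?w X * tr (X \<inter> ?M)) + (\<Sum>X\<in>Pow {1..n}. ?w X * nt (X \<inter> ?M))"
    by (simp add: distrib_left sum.distrib)
  also have "(\<Sum>X\<in>Pow {1..n}. ?w X * tr (X \<inter> ?M)) \<le> 4 * ?Z"
  proof -
    have "(\<Sum>X\<in>Pow {1..n}. ?w X * tr (X \<inter> ?M)) = (\<Sum>A\<in>Pow ?M. tr A * W A)"
      unfolding W_def by (rule sum_weight_split[OF assms(1)])
    also have "\<dots> = (\<Sum>A\<in>Pow ?M. 2 * W A + of_bool (A = {}) * (2 ^ m * W A) + of_bool (A = ?M) * (2 ^ m * W A))"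
      by (intro sum.cong refl) (simp add: tr_def algebra_simps)
    also have "\<dots> = 2 * ?Z + (\<Sum>A\<in>Pow ?M. of_bool (A = {}) * (2 ^ m * W A)) + (\<Sum>A\<in>Pow ?M. of_bool (A = ?M) * (2 ^ m * W A))"
      unfolding total_weight_split[OF assms(1)] W_def[symmetric] by (simp only: sum.distrib sum_distrib_left)
    also have "\<dots> = 2 * ?Z + 2 ^ m * W {} + 2 ^ m * W ?M"
    proof -
      have "(\<Sum>A\<in>Pow ?M. of_bool (A = B) * g A) = g B" if "B \<in> Pow ?M" for B and g :: "nat set \<Rightarrow> real"
      proof -
        have "(\<Sum>A\<in>Pow ?M. of_bool (A = B) * g A) = (\<Sum>A\<in>Pow ?M. if A = B then g A else 0)"
          by (intro sum.cong) auto
        then show ?thesis using that by simp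
      qed
      from this[of "{}" "\<lambda>A. 2 ^ m * W A"] this[of ?M "\<lambda>A. 2 ^ m * W A"] show ?thesis by simp
    qed
    also have "\<dots> \<le> 4 * ?Z"
      using trivial_restriction_weight[OF assms(1) disjI1[OF refl], of k] trivial_restriction_weight[OF assms(1) disjI2[OF refl], of k]
      unfolding W_def by linarith
    finally show ?thesis .
  qed
  also have "(\<Sum>X\<in>Pow {1..n}. ?w X * nt (X \<inter> ?M)) \<le> 5 * K\<^sup>2 * (real n + 1) * (3 / 4) ^ m * ?Z"
  proof -
    have nt0: "nt A \<ge> 0" for A
      unfolding nt_def nontrivial_part_def using assms(2)
      by (intro sum_nonneg add_nonneg_nonneg mult_nonneg_nonneg splits_nonneg) auto
    have W: "W A \<le> (real n + 1) * ?Z * (1 / 2) ^ m" if "A \<in> Pow ?M" for A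
      using restriction_weight_le[OF assms(1), of A k] that unfolding W_def by (simp add: field_simps)
    have "(\<Sum>X\<in>Pow {1..n}. ?w X * nt (X \<inter> ?M)) = (\<Sum>A\<in>Pow ?M. nt A * W A)"
      unfolding W_def by (rule sum_weight_split[OF assms(1)])
    also have "\<dots> \<le> (\<Sum>A\<in>Pow ?M. nt A * ((real n + 1) * ?Z * (1 / 2) ^ m))"
      using nt0 W by (intro sum_mono mult_left_mono)
    also have "\<dots> = (\<Sum>A\<in>Pow ?M. nt A) * ((real n + 1) * ?Z * (1 / 2) ^ m)"
      by (simp add: sum_distrib_right)
    also have "\<dots> \<le> (5 * K\<^sup>2 * (3 / 2) ^ m) * ((real n + 1) * ?Z * (1 / 2) ^ m)"
    proof (rule mult_right_mono)
      have "(\<Sum>A\<in>Pow ?M. nt A) = (\<Sum>c\<in>Pow ?M. \<Sum>A\<in>Pow ?M. nontrivial_part K ?M c A)"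
        unfolding nt_def by (rule sum.swap)
      then show "(\<Sum>A\<in>Pow ?M. nt A) \<le> 5 * K\<^sup>2 * (3 / 2) ^ m"
        using sum_nontrivial_part[of ?M K] assms(2) by simp
    qed (simp add: total_weight_pos less_imp_le)
    also have "\<dots> = 5 * K\<^sup>2 * (real n + 1) * ((3 / 2) ^ m * (1 / 2) ^ m) * ?Z" by simp
    also have "(3 / 2) ^ m * (1 / 2) ^ m = (3 / 4 :: real) ^ m" by (simp flip: power_mult_distrib)
    finally show ?thesis .
  qed
  finally show ?thesis by (simp add: algebra_simps)
qed

section \<open>Counting graphs with two colourings\<close>

lemma card_mono_within:
  assumes "finite S" "c \<subseteq> S" "k \<ge> 1"
  shows "card {e \<in> nsets S k. e \<subseteq> c \<or> e \<inter> c = {}} = (card c choose k) + (card (S - c) choose k)"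
proof -
  have "{e \<in> nsets S k. e \<subseteq> c \<or> e \<inter> c = {}} = nsets c k \<union> nsets (S - c) k"
    using assms(2) unfolding nsets_def by blast
  moreover have "nsets c k \<inter> nsets (S - c) k = {}"
  proof -
    have "e \<noteq> {}" if "e \<in> nsets c k" for e using that assms(3) by (auto simp: nsets_def)
    moreover have "e = {}" if "e \<in> nsets c k" "e \<in> nsets (S - c) k" for e
      using that unfolding nsets_def by blast
    ultimately show ?thesis by fastforce
  qed
  moreover have "finite c" "finite (S - c)" using assms(1,2) finite_subset by auto
  ultimately show ?thesis by (simp add: card_Un_disjoint finite_imp_finite_nsets)
qed

lemma card_mono_sets:
  assumes "c \<subseteq> {1..m}" "k \<ge> 1"
  shows "card (mono_sets k m c) = (card c choose k) + (m - card c choose k)"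
proof -
  have "card ({1..m} - c) = m - card c" using assms(1) by (simp add: card_Diff_subset finite_subset)
  then show ?thesis using card_mono_within[of "{1..m}" c k] assms by (simp add: mono_sets_def)
qed

text \<open>By convexity, fewest sets cross if one part is a single vertex. The crossing sets are
  then those through this vertex.\<close>

lemma card_crossing_ge:
  assumes "finite c" "P \<subseteq> c" "P \<noteq> {}" "P \<noteq> c" "k \<ge> 2"
  shows "(card c - 1 choose (k - 1)) \<le> card {e \<in> nsets c k. \<not> (e \<subseteq> P \<or> e \<inter> P = {})}"
proof -
  define p q where "p = card P - 1" and "q = card (c - P) - 1"
  have "finite P" "c - P \<noteq> {}" using assms finite_subset by auto
  then have pq: "card P = 1 + p" "card (c - P) = 1 + q"
    using assms by (simp_all add: p_def q_def Suc_leI card_gt_0_iff)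
  have c: "card c = Suc (1 + p + q)"
    using card_Diff_subset[OF \<open>finite P\<close> assms(2)] card_mono[OF assms(1,2)] pq by linarith
  \<comment> \<open>Moving \<open>p\<close> vertices to the other part leaves parts of sizes 1 and
    \<open>card c - 1\<close>.\<close>
  have "(1 + p choose k) + (1 + q choose k) \<le> (1 choose k) + (1 + q + p choose k)"
    by (rule choose_spread) simp
  then have "(card P choose k) + (card (c - P) choose k) \<le> (card c - 1 choose k)"
    using assms(5) c pq by (simp add: binomial_eq_0 add_ac)
  moreover have "(card c choose k) = (card c - 1 choose (k - 1)) + (card c - 1 choose k)"
    using assms(5) c by (cases k) simp_all
  moreover have "card {e \<in> nsets c k. \<not> (e \<subseteq> P \<or> e \<inter> P = {})} + card {e \<in> nsets c k. e \<subseteq> P \<or> e \<inter> P = {}} = card (nsets c k)"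
  proof -
    have "{e \<in> nsets c k. \<not> (e \<subseteq> P \<or> e \<inter> P = {})} = nsets c k - {e \<in> nsets c k. e \<subseteq> P \<or> e \<inter> P = {}}" by blast
    moreover have "card {e \<in> nsets c k. e \<subseteq> P \<or> e \<inter> P = {}} \<le> card (nsets c k)"
      using assms(1) by (intro card_mono) (auto simp: finite_imp_finite_nsets)
    ultimately show ?thesis using assms(1) by (simp add: card_Diff_subset finite_imp_finite_nsets)
  qed
  ultimately show ?thesis using card_mono_within[OF assms(1,2), of k] assms(5) by simp
qed

lemma crossing_penalty:
  assumes "finite c" "P \<subseteq> c" "k \<ge> 2" "\<And>t. (1 / 2) ^ (t - 1 choose (k - 1)) \<le> K * (1 / 4) ^ t"
  shows "(1 / 2 :: real) ^ card {e \<in> nsets c k. \<not> (e \<subseteq> P \<or> e \<inter> P = {})} \<le> trivial_split c P + proper_split K c P"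
proof (cases "P = {} \<or> P = c")
  case True
  have "(1 / 2 :: real) ^ card {e \<in> nsets c k. \<not> (e \<subseteq> P \<or> e \<inter> P = {})} \<le> 1" by (rule power_le_one) auto
  then show ?thesis using True by (simp only: trivial_split_def proper_split_def if_True)
next
  case False
  then have "(1 / 2 :: real) ^ card {e \<in> nsets c k. \<not> (e \<subseteq> P \<or> e \<inter> P = {})} \<le> (1 / 2) ^ (card c - 1 choose (k - 1))"
    using card_crossing_ge[OF assms(1,2) _ _ assms(3)] by (intro power_decreasing) auto
  also have "\<dots> \<le> K * (1 / 4) ^ card c" by (rule assms(4))
  finally show ?thesis using False by (simp only: trivial_split_def proper_split_def if_False)
qed

text \<open>A \<open>k\<close>-set inside one class of \<open>c\<close> that meets both sides of
  \<open>X\<close> is monochromatic for \<open>c\<close> only. Requiring \<open>c\<close> to be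
  proper forbids it in addition to the sets forbidden by \<open>X\<close>.\<close>

lemma card_mono_diff_ge:
  assumes "m \<le> n" "c \<subseteq> {1..m}" "k \<ge> 1"
  shows "card {e \<in> nsets c k. \<not> (e \<subseteq> X \<inter> c \<or> e \<inter> (X \<inter> c) = {})} +
      card {e \<in> nsets ({1..m} - c) k. \<not> (e \<subseteq> X \<inter> ({1..m} - c) \<or> e \<inter> (X \<inter> ({1..m} - c)) = {})}
    \<le> card (mono_sets k m c - mono_sets k n X)" (is "card ?A + card ?B \<le> card ?D")
proof -
  have fin: "finite ?A" "finite ?B"
    using assms(2) finite_subset by (auto intro!: finite_subset[OF _ finite_imp_finite_nsets])
  have "e \<notin> ?B" if "e \<in> ?A" for e
  proof
    assume "e \<in> ?B"
    then have "e = {}" using that unfolding nsets_def by blast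
    then show False using that by simp
  qed
  then have "?A \<inter> ?B = {}" by blast
  then have "card ?A + card ?B = card (?A \<union> ?B)" using fin by (simp add: card_Un_disjoint)
  also have "\<dots> \<le> card ?D"
  proof (rule card_mono)
    show "finite ?D" by (simp add: mono_sets_def finite_imp_finite_nsets)
    show "?A \<union> ?B \<subseteq> ?D"
    proof
      fix e assume "e \<in> ?A \<union> ?B"
      then consider "e \<in> ?A" | "e \<in> ?B" by blast
      then show "e \<in> ?D"
      proof cases
        case 1
        then have e: "e \<subseteq> c" "finite e" "card e = k" "\<not> e \<subseteq> X \<inter> c" "e \<inter> (X \<inter> c) \<noteq> {}"
          by (simp_all only: nsets_def mem_Collect_eq de_Morgan_disj simp_thms)
        from e(1,4,5) have "\<not> e \<subseteq> X" "e \<inter> X \<noteq> {}" by auto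
        moreover have "e \<subseteq> {1..m}" using e(1) assms(2) by (rule subset_trans)
        ultimately show ?thesis using e by (simp add: mono_sets_def nsets_def)
      next
        case 2
        then have e: "e \<subseteq> {1..m} - c" "finite e" "card e = k" "\<not> e \<subseteq> X \<inter> ({1..m} - c)"
          "e \<inter> (X \<inter> ({1..m} - c)) \<noteq> {}"
          by (simp_all only: nsets_def mem_Collect_eq de_Morgan_disj simp_thms)
        from e(1,4,5) have "\<not> e \<subseteq> X" "e \<inter> X \<noteq> {}" "e \<inter> c = {}" "e \<subseteq> {1..m}" by auto
        then show ?thesis using e(2,3) by (simp add: mono_sets_def nsets_def)
      qed
    qed
  qed
  finally show ?thesis .
qed

lemma card_avoiding:
  assumes "finite U" "M \<subseteq> U"
  shows "real (card {E \<in> Pow U. E \<inter> M = {}}) = 2 ^ card U * (1 / 2) ^ card M"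
proof -
  have "{E \<in> Pow U. E \<inter> M = {}} = Pow (U - M)" by blast
  then have "real (card {E \<in> Pow U. E \<inter> M = {}}) = 2 ^ (card U - card M)"
    using assms by (simp add: card_Pow card_Diff_subset finite_subset)
  moreover have "card M \<le> card U" using assms by (rule card_mono)
  ultimately show ?thesis by (simp add: power_diff power_divide)
qed

abbreviation "edge_sets k n \<equiv> Pow (nsets {1..n} k)"

text \<open>Pairs of a graph and a colouring are counted by the colouring; each of its monochromatic
  \<open>k\<close>-sets halves the number of graphs.\<close>

lemma sum_card_colourings:
  assumes "k \<ge> 1"
  shows "(\<Sum>E\<in>edge_sets k n. real (card (colourings k n E))) =
    2 ^ card (nsets {1..n} k) * total_weight k n"
proof -
  have "(\<Sum>E\<in>edge_sets k n. real (card (colourings k n E))) =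
      (\<Sum>E\<in>edge_sets k n. \<Sum>X\<in>Pow {1..n}. of_bool (E \<inter> mono_sets k n X = {}))"
    by (intro sum.cong refl) (simp add: colourings_def of_bool_def sum.If_cases Int_def)
  also have "\<dots> = (\<Sum>X\<in>Pow {1..n}. \<Sum>E\<in>edge_sets k n. of_bool (E \<inter> mono_sets k n X = {}))"
    by (rule sum.swap)
  also have "\<dots> = (\<Sum>X\<in>Pow {1..n}. 2 ^ card (nsets {1..n} k) * weight k n (card X))"
  proof (rule sum.cong[OF refl])
    fix X assume "X \<in> Pow {1..n}"
    then have X: "X \<subseteq> {1..n}" by simp
    have "(\<Sum>E\<in>edge_sets k n. of_bool (E \<inter> mono_sets k n X = {}) :: real) =
        real (card {E \<in> edge_sets k n. E \<inter> mono_sets k n X = {}})"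
      by (simp add: of_bool_def sum.If_cases finite_imp_finite_nsets Int_def)
    also have "\<dots> = 2 ^ card (nsets {1..n} k) * (1 / 2) ^ card (mono_sets k n X)"
      by (intro card_avoiding) (auto simp: finite_imp_finite_nsets mono_sets_def)
    finally show "(\<Sum>E\<in>edge_sets k n. of_bool (E \<inter> mono_sets k n X = {})) = 2 ^ card (nsets {1..n} k) * weight k n (card X)"
      unfolding weight_def card_mono_sets[OF X assms] .
  qed
  finally show ?thesis by (simp add: total_weight_def sum_distrib_left)
qed

text \<open>Triples are counted by the two colourings. The sets forbidden by \<open>X\<close>
  produce its weight; those forbidden only by \<open>c\<close> produce a penalty for each class of
  \<open>c\<close> that \<open>X\<close> splits.\<close>

lemma sum_card_colourings_product:
  assumes "m \<le> n" "k \<ge> 3" "K \<ge> 1" "\<And>t. (1 / 2) ^ (t - 1 choose (k - 1)) \<le> K * (1 / 4) ^ t"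
  shows "(\<Sum>E\<in>edge_sets k n. real (card (colourings k n E)) * real (card (colourings k m E))) \<le>
    (4 + 5 * K\<^sup>2 * (real n + 1) * (3 / 4) ^ m) * (\<Sum>E\<in>edge_sets k n. real (card (colourings k n E)))"
proof -
  let ?N = "card (nsets {1..n} k)"
  let ?b = "\<lambda>m c E. of_bool (E \<inter> mono_sets k m c = {}) :: real"
  let ?h = "\<lambda>X c. (trivial_split c (X \<inter> c) + proper_split K c (X \<inter> c)) *
       (trivial_split ({1..m} - c) (X \<inter> ({1..m} - c)) + proper_split K ({1..m} - c) (X \<inter> ({1..m} - c)))"
  have col: "real (card (colourings k m E)) = (\<Sum>c\<in>Pow {1..m}. ?b m c E)" for m E
    by (simp add: colourings_def of_bool_def sum.If_cases Int_def)
  have "(\<Sum>E\<in>edge_sets k n. real (card (colourings k n E)) * real (card (colourings k m E))) =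
      (\<Sum>E\<in>edge_sets k n. \<Sum>X\<in>Pow {1..n}. \<Sum>c\<in>Pow {1..m}. ?b n X E * ?b m c E)"
    unfolding col sum_product ..
  also have "\<dots> = (\<Sum>X\<in>Pow {1..n}. \<Sum>E\<in>edge_sets k n. \<Sum>c\<in>Pow {1..m}. ?b n X E * ?b m c E)"
    by (rule sum.swap)
  also have "\<dots> = (\<Sum>X\<in>Pow {1..n}. \<Sum>c\<in>Pow {1..m}. \<Sum>E\<in>edge_sets k n. ?b n X E * ?b m c E)"
    by (intro sum.cong refl sum.swap)
  also have "\<dots> \<le> (\<Sum>X\<in>Pow {1..n}. \<Sum>c\<in>Pow {1..m}. 2 ^ ?N * (weight k n (card X) * ?h X c))"
  proof (rule sum_mono, rule sum_mono)
    fix X c assume "X \<in> Pow {1..n}" "c \<in> Pow {1..m}"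
    then have X: "X \<subseteq> {1..n}" and c: "c \<subseteq> {1..m}" by auto
    let ?M = "mono_sets k n X" and ?D = "mono_sets k m c - mono_sets k n X"
    let ?A = "{e \<in> nsets c k. \<not> (e \<subseteq> X \<inter> c \<or> e \<inter> (X \<inter> c) = {})}"
      and ?B = "{e \<in> nsets ({1..m} - c) k. \<not> (e \<subseteq> X \<inter> ({1..m} - c) \<or> e \<inter> (X \<inter> ({1..m} - c)) = {})}"
    have fin: "finite ?M" "finite ?D" by (simp_all add: mono_sets_def finite_imp_finite_nsets)
    have "nsets {1..m} k \<subseteq> nsets {1..n} k" using assms(1) by (intro nsets_mono) auto
    then have sub: "?M \<union> ?D \<subseteq> nsets {1..n} k" unfolding mono_sets_def by blast
    have "(\<Sum>E\<in>edge_sets k n. ?b n X E * ?b m c E) = (\<Sum>E\<in>edge_sets k n. of_bool (E \<inter> (?M \<union> ?D) = {}))"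
    proof (rule sum.cong[OF refl])
      fix E
      have "E \<inter> (?M \<union> ?D) = {} \<longleftrightarrow> E \<inter> ?M = {} \<and> E \<inter> mono_sets k m c = {}" by blast
      then show "?b n X E * ?b m c E = of_bool (E \<inter> (?M \<union> ?D) = {})" by (simp only: of_bool_conj)
    qed
    also have "\<dots> = real (card {E \<in> edge_sets k n. E \<inter> (?M \<union> ?D) = {}})"
      by (simp add: of_bool_def sum.If_cases finite_imp_finite_nsets Int_def)
    also have "\<dots> = 2 ^ ?N * (1 / 2) ^ card (?M \<union> ?D)"
      by (rule card_avoiding[OF _ sub]) (simp add: finite_imp_finite_nsets)
    also have "card (?M \<union> ?D) = card ?M + card ?D" by (rule card_Un_disjoint) (use fin in auto)
    also have "2 ^ ?N * (1 / 2 :: real) ^ (card ?M + card ?D) = 2 ^ ?N * (weight k n (card X) * (1 / 2) ^ card ?D)"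
      using card_mono_sets[OF X, of k] assms(2) by (simp add: weight_def power_add)
    also have "\<dots> \<le> 2 ^ ?N * (weight k n (card X) * ?h X c)"
    proof (intro mult_left_mono)
      have "card ?A + card ?B \<le> card ?D" using assms(1,2) c by (intro card_mono_diff_ge) auto
      then have "(1 / 2 :: real) ^ card ?D \<le> (1 / 2) ^ (card ?A + card ?B)" by (intro power_decreasing) auto
      also have "\<dots> = (1 / 2) ^ card ?A * (1 / 2) ^ card ?B" by (rule power_add)
      also have "\<dots> \<le> ?h X c"
      proof (rule mult_mono)
        show "(1 / 2) ^ card ?A \<le> trivial_split c (X \<inter> c) + proper_split K c (X \<inter> c)"
          using c assms(2) by (intro crossing_penalty assms(4)) (auto intro: finite_subset)
        show "(1 / 2) ^ card ?B \<le> trivial_split ({1..m} - c) (X \<inter> ({1..m} - c)) + proper_split K ({1..m} - c) (X \<inter> ({1..m} - c))"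
          using assms(2) by (intro crossing_penalty assms(4)) auto
        show "0 \<le> trivial_split c (X \<inter> c) + proper_split K c (X \<inter> c)"
          using assms(3) by (intro add_nonneg_nonneg splits_nonneg) auto
      qed simp
      finally show "(1 / 2) ^ card ?D \<le> ?h X c" .
    qed (simp_all add: weight_pos less_imp_le)
    finally show "(\<Sum>E\<in>edge_sets k n. ?b n X E * ?b m c E) \<le> 2 ^ ?N * (weight k n (card X) * ?h X c)" .
  qed
  also have "\<dots> = 2 ^ ?N * (\<Sum>X\<in>Pow {1..n}. \<Sum>c\<in>Pow {1..m}. weight k n (card X) * ?h X c)"
    by (simp only: sum_distrib_left)
  also have "\<dots> \<le> 2 ^ ?N * ((4 + 5 * K\<^sup>2 * (real n + 1) * (3 / 4) ^ m) * total_weight k n)"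
    by (intro mult_left_mono split_sum_le assms(1,3)) simp
  also have "\<dots> = (4 + 5 * K\<^sup>2 * (real n + 1) * (3 / 4) ^ m) * (\<Sum>E\<in>edge_sets k n. real (card (colourings k n E)))"
    using assms(2) by (subst sum_card_colourings) simp_all
  finally show ?thesis .
qed

section \<open>Averages over the bipartite graphs\<close>

lemma power_bound_34: "(real n + 1) * (3 / 4) ^ n \<le> 3"
proof -
  have "1 + real n * (1 / 3) \<le> (1 + 1 / 3) ^ n" by (rule Bernoulli_inequality) simp
  then have "(real n + 1) * (3 / 4) ^ n \<le> (3 * (4 / 3) ^ n) * (3 / 4) ^ n" by (intro mult_right_mono) auto
  also have "\<dots> = 3 * ((4 / 3) ^ n * (3 / 4) ^ n)" by simp
  also have "(4 / 3) ^ n * (3 / 4) ^ n = (1::real)" by (simp flip: power_mult_distrib)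
  finally show ?thesis by simp
qed

text \<open>Let \<open>Z\<close> count pairs of a graph and a proper colouring. Cauchy's inequality
  and the product bound for \<open>m = n\<close> give \<open>Z * Z <= D * Z * card B\<close> with
  \<open>D = 4 + 15 * K^2\<close>, hence \<open>Z <= D * card B\<close>. For general
  \<open>m\<close>, weighting each graph in \<open>B\<close> by its number of colourings, which is
  at least 1, only increases the sum and makes the product bound applicable.\<close>

lemma average_colourings:
  assumes "m \<le> n" "k \<ge> 3" "K \<ge> 1" "\<And>t. (1 / 2) ^ (t - 1 choose (k - 1)) \<le> K * (1 / 4) ^ t"
  defines "B \<equiv> {E \<in> edge_sets k n. colourings k n E \<noteq> {}}"
  shows "(\<Sum>E\<in>B. real (card (colourings k m E))) \<le>
    (4 + 5 * K\<^sup>2 * (real n + 1) * (3 / 4) ^ m) * (4 + 15 * K\<^sup>2) * card B"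
proof -
  let ?col = "\<lambda>m E. real (card (colourings k m E))"
  let ?D = "4 + 15 * K\<^sup>2"
  define Z where "Z = (\<Sum>E\<in>edge_sets k n. ?col n E)"
  have fin: "finite (edge_sets k n)" by (simp add: finite_imp_finite_nsets)
  have B: "B \<subseteq> edge_sets k n" unfolding B_def by blast
  have zero: "?col n E = 0" if "E \<in> edge_sets k n - B" for E using that by (simp add: B_def)
  have ZB: "Z = (\<Sum>E\<in>B. ?col n E)"
    unfolding Z_def by (rule sum.mono_neutral_right[OF fin B]) (use zero in blast)
  have "Z > 0" unfolding Z_def using assms(2) by (subst sum_card_colourings) (simp_all add: total_weight_pos)
  have "Z\<^sup>2 \<le> (\<Sum>E\<in>B. (?col n E)\<^sup>2) * card B"
    unfolding ZB by (rule sum_squared_le_sum_of_squares)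
  also have "(\<Sum>E\<in>B. (?col n E)\<^sup>2) \<le> (\<Sum>E\<in>edge_sets k n. ?col n E * ?col n E)"
    unfolding power2_eq_square by (rule sum_mono2[OF fin B]) simp
  also have "\<dots> \<le> (4 + 5 * K\<^sup>2 * (real n + 1) * (3 / 4) ^ n) * Z"
    unfolding Z_def by (rule sum_card_colourings_product[OF order_refl assms(2-4)])
  also have "\<dots> \<le> ?D * Z"
  proof (rule mult_right_mono)
    have "5 * K\<^sup>2 * ((real n + 1) * (3 / 4) ^ n) \<le> 5 * K\<^sup>2 * 3"
      by (intro mult_left_mono power_bound_34) simp
    then show "4 + 5 * K\<^sup>2 * (real n + 1) * (3 / 4) ^ n \<le> ?D" by (simp add: mult.assoc)
  qed (use \<open>Z > 0\<close> in simp)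
  finally have "Z * Z \<le> (?D * card B) * Z"
    by (simp add: power2_eq_square mult_right_mono mult_ac)
  then have Z: "Z \<le> ?D * card B" using \<open>Z > 0\<close> by simp
  have "(\<Sum>E\<in>B. ?col m E) \<le> (\<Sum>E\<in>B. ?col n E * ?col m E)"
  proof (rule sum_mono)
    fix E assume "E \<in> B"
    then have "1 \<le> ?col n E"
      using finite_colourings[of k n E] by (simp add: B_def Suc_leI card_gt_0_iff)
    then have "1 * ?col m E \<le> ?col n E * ?col m E" by (intro mult_right_mono) auto
    then show "?col m E \<le> ?col n E * ?col m E" by simp
  qed
  also have "\<dots> \<le> (\<Sum>E\<in>edge_sets k n. ?col n E * ?col m E)"
    by (rule sum_mono2[OF fin B]) simp
  also have "\<dots> \<le> (4 + 5 * K\<^sup>2 * (real n + 1) * (3 / 4) ^ m) * Z"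
    unfolding Z_def by (rule sum_card_colourings_product[OF assms(1-4)])
  also have "\<dots> \<le> (4 + 5 * K\<^sup>2 * (real n + 1) * (3 / 4) ^ m) * (?D * card B)"
    by (intro mult_left_mono Z) simp
  finally show ?thesis by (simp add: mult.assoc)
qed

text \<open>With \<open>q = r * r\<close>, each induction step spends one factor
  \<open>r ^ m\<close> on one factor \<open>Suc m\<close>; that product is at most the geometric
  series of \<open>r\<close>.\<close>

lemma power_times_exp_bounded:
  fixes q :: real
  assumes "0 \<le> q" "q < 1"
  shows "\<exists>C. \<forall>m. real (Suc m) ^ j * q ^ m \<le> C"
  using assms
proof (induction j arbitrary: q)
  case 0
  then show ?case by (intro exI[of _ 1]) (simp add: power_le_one)
next
  case (Suc j)
  define r where "r = sqrt q"
  have r: "0 \<le> r" "r < 1" "q = r * r" using Suc.prems by (simp_all add: r_def real_less_lsqrt)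
  obtain C where C: "\<And>m. real (Suc m) ^ j * r ^ m \<le> C" using Suc.IH[OF r(1,2)] by blast
  have lin: "real (Suc m) * r ^ m \<le> 1 / (1 - r)" for m
  proof -
    have "real (Suc m) * r ^ m = (\<Sum>i\<le>m. r ^ m)" by simp
    also have "\<dots> \<le> (\<Sum>i\<le>m. r ^ i)" using r by (intro sum_mono power_decreasing) auto
    also have "\<dots> = (1 - r ^ Suc m) / (1 - r)" using r(2) by (subst sum_gp0) auto
    also have "\<dots> \<le> 1 / (1 - r)" using r by (intro divide_right_mono) auto
    finally show ?thesis .
  qed
  have "real (Suc m) ^ Suc j * q ^ m \<le> 1 / (1 - r) * C" for m
  proof -
    have "real (Suc m) ^ Suc j * q ^ m = (real (Suc m) * r ^ m) * (real (Suc m) ^ j * r ^ m)"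
      unfolding r(3) power_mult_distrib by (simp del: of_nat_Suc)
    also have "\<dots> \<le> 1 / (1 - r) * C" using r by (intro mult_mono lin C) auto
    finally show ?thesis .
  qed
  then show ?case by blast
qed

section \<open>The average running time\<close>

lemma node_cost_le:
  assumes "k \<ge> 1"
  shows "real (node_cost k (Suc m)) \<le> real (160 * k + 310) * real (Suc m) ^ (k - 1)"
proof -
  have "node_cost k (Suc m) = (40 * k + 210) * 1 + Suc m ^ (k - 1) * (120 * k + 100)"
    by (simp add: node_cost_def check_cost_def algebra_simps)
  also have "\<dots> \<le> (40 * k + 210) * Suc m ^ (k - 1) + Suc m ^ (k - 1) * (120 * k + 100)"
    by (intro add_right_mono mult_left_mono one_le_power) auto
  also have "\<dots> = (160 * k + 310) * Suc m ^ (k - 1)" by (simp add: algebra_simps)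
  finally have "real (node_cost k (Suc m)) \<le> real ((160 * k + 310) * Suc m ^ (k - 1))"
    by (simp only: of_nat_le_iff)
  then show ?thesis by simp
qed

lemma bip_class_edge_sets:
  shows "inj_on snd (bip_class k n)"
    and "snd ` bip_class k n = {E \<in> edge_sets k n. colourings k n E \<noteq> {}}"
proof -
  show "inj_on snd (bip_class k n)"
    by (rule inj_onI) (simp add: bip_class_def prod_eq_iff)
  have "E \<in> snd ` bip_class k n \<longleftrightarrow> E \<in> edge_sets k n \<and> colourings k n E \<noteq> {}" for E
  proof -
    have "E \<in> snd ` bip_class k n \<longleftrightarrow> ({1..n}, E) \<in> bip_class k n"
      by (force simp: bip_class_def)
    also have "\<dots> \<longleftrightarrow> kgraph k ({1..n}, E) \<and> colourings k n E \<noteq> {}"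
      using bipartite_iff_colourings[of "({1..n}, E)" n k] by (auto simp: bip_class_def)
    finally show ?thesis by (simp add: kgraph_def)
  qed
  then show "snd ` bip_class k n = {E \<in> edge_sets k n. colourings k n E \<noteq> {}}" by blast
qed

text \<open>Level \<open>m\<close> costs order \<open>m ^ (k - 1)\<close> per proper colouring. The
  bounded part of the average number of colourings contributes order \<open>n ^ k\<close> over all
  levels. In the error part \<open>(3 / 4) ^ m\<close> absorbs the check cost up to the constant
  \<open>M\<close>, leaving order \<open>n ^ 2\<close>.\<close>

lemma average_running_time:
  assumes "k \<ge> 3"
  shows "\<exists>C. \<forall>n\<ge>1. (\<Sum>H\<in>bip_class k n. real (running_time prog k H)) \<le> C * real n ^ k * card (bip_class k n)"
proof -
  obtain K :: real where K: "K \<ge> 1" "\<And>t. (1 / 2) ^ (t - 1 choose (k - 1)) \<le> K * (1 / 4) ^ t"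
    using split_bound[OF assms] by blast
  obtain M where M: "\<And>m. real (Suc m) ^ (k - 1) * (3 / 4) ^ m \<le> M"
    using power_times_exp_bounded[of "3 / 4" "k - 1"] by auto
  have M0: "M \<ge> 0" using M[of 0] by simp
  define L where "L = real (160 * k + 310)"
  define D where "D = 4 + 15 * K\<^sup>2"
  have LD: "L \<ge> 0" "D \<ge> 0" by (simp_all add: L_def D_def)
  have "(\<Sum>H\<in>bip_class k n. real (running_time prog k H)) \<le>
      (30 + L * D * (4 + 10 * K\<^sup>2 * M)) * real n ^ k * card (bip_class k n)" if n: "n \<ge> 1" for n
  proof -
    define B where "B = {E \<in> edge_sets k n. colourings k n E \<noteq> {}}"
    have cB: "card B = card (bip_class k n)"
      unfolding B_def bip_class_edge_sets(2)[symmetric] by (rule card_image[OF bip_class_edge_sets(1)])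
    let ?T = "\<lambda>E. 30 + (\<Sum>m<n. real (node_cost k (Suc m)) * real (card (colourings k m E)))"
    have avg: "(\<Sum>E\<in>B. real (card (colourings k m E))) \<le>
        (4 + 5 * K\<^sup>2 * (real n + 1) * (3 / 4) ^ m) * D * card B" if "m < n" for m
      unfolding B_def D_def using that by (intro average_colourings assms K) simp
    have "(\<Sum>H\<in>bip_class k n. real (running_time prog k H)) \<le> (\<Sum>H\<in>bip_class k n. ?T (snd H))"
    proof (rule sum_mono)
      fix H assume "H \<in> bip_class k n"
      then have "real (running_time prog k H) \<le>
          real (30 + (\<Sum>m<n. node_cost k (Suc m) * card (colourings k m (snd H))))"
        using prog_correct(2)[of k H n] assms by (simp only: of_nat_le_iff)
      then show "real (running_time prog k H) \<le> ?T (snd H)" by simp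
    qed
    also have "\<dots> = (\<Sum>E\<in>B. ?T E)"
      unfolding B_def bip_class_edge_sets(2)[symmetric] by (simp add: sum.reindex[OF bip_class_edge_sets(1)])
    also have "\<dots> = 30 * card B + (\<Sum>m<n. real (node_cost k (Suc m)) * (\<Sum>E\<in>B. real (card (colourings k m E))))"
      by (simp add: sum.distrib sum_distrib_left sum.swap[of _ B])
    also have "\<dots> \<le> 30 * card B + (\<Sum>m<n. L * D * (4 * real n ^ (k - 1) + 5 * K\<^sup>2 * M * (real n + 1)) * card B)"
    proof (intro add_left_mono sum_mono)
      fix m assume "m \<in> {..<n}"
      then have m: "m < n" by simp
      let ?q = "4 + 5 * K\<^sup>2 * (real n + 1) * (3 / 4) ^ m" and ?s = "real (Suc m) ^ (k - 1)"
      have "real (node_cost k (Suc m)) * (\<Sum>E\<in>B. real (card (colourings k m E))) \<le>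
          (L * ?s) * (?q * D * card B)"
        unfolding L_def using assms LD
        by (intro mult_mono avg m node_cost_le) (auto intro!: sum_nonneg)
      also have "\<dots> = L * D * (4 * ?s + 5 * K\<^sup>2 * (?s * (3 / 4) ^ m) * (real n + 1)) * card B"
        by (simp add: algebra_simps)
      also have "\<dots> \<le> L * D * (4 * real n ^ (k - 1) + 5 * K\<^sup>2 * M * (real n + 1)) * card B"
        using m LD M by (intro mult_right_mono mult_left_mono add_mono power_mono) auto
      finally show "real (node_cost k (Suc m)) * (\<Sum>E\<in>B. real (card (colourings k m E))) \<le>
          L * D * (4 * real n ^ (k - 1) + 5 * K\<^sup>2 * M * (real n + 1)) * card B" .
    qed
    also have "\<dots> = (30 + L * D * (4 * (real n * real n ^ (k - 1)) + 5 * K\<^sup>2 * M * (real n * (real n + 1)))) * card B"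
      by (simp add: algebra_simps)
    also have "\<dots> \<le> (30 * real n ^ k + L * D * (4 * real n ^ k + 5 * K\<^sup>2 * M * (2 * real n ^ k))) * card B"
    proof (intro mult_right_mono add_mono mult_left_mono)
      show "real n * real n ^ (k - 1) \<le> real n ^ k" using assms by (cases k) auto
      have "real n * (real n + 1) \<le> 2 * real n ^ 2" using n by (simp add: power2_eq_square algebra_simps)
      also have "\<dots> \<le> 2 * real n ^ k" using n assms by (intro mult_left_mono power_increasing) auto
      finally show "real n * (real n + 1) \<le> 2 * real n ^ k" .
      show "30 \<le> 30 * real n ^ k" using n by simp
    qed (use LD M0 in auto)
    also have "\<dots> = (30 + L * D * (4 + 10 * K\<^sup>2 * M)) * real n ^ k * card (bip_class k n)"
      by (simp add: cB algebra_simps)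
    finally show ?thesis .
  qed
  then show ?thesis by blast
qed

theorem theoremA:
  "\<exists>P :: com. \<forall>k :: nat. k \<ge> 3 \<longrightarrow>
     (\<forall>n :: nat. \<forall>H \<in> bip_class k n.
        \<exists>t s. run P k H t s \<and> bipartition H (colour_X H s) (colour_Y H s)) \<and>
     (\<lambda>n :: nat. (\<Sum>H \<in> bip_class k n. real (running_time P k H)) / real (card (bip_class k n)))
       \<in> O(\<lambda>n. real n ^ k)"
proof (intro exI[of _ prog] allI impI conjI ballI)
  fix k n H assume "k \<ge> (3::nat)" "H \<in> bip_class k n"
  then show "\<exists>t s. run prog k H t s \<and> bipartition H (colour_X H s) (colour_Y H s)"
    by (intro prog_correct(1)) auto
next
  fix k :: nat assume k: "k \<ge> 3"
  obtain C where C: "\<And>n. n \<ge> 1 \<Longrightarrow> (\<Sum>H\<in>bip_class k n. real (running_time prog k H)) \<le>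
      C * real n ^ k * card (bip_class k n)"
    using average_running_time[OF k] by blast
  show "(\<lambda>n. (\<Sum>H \<in> bip_class k n. real (running_time prog k H)) / real (card (bip_class k n)))
      \<in> O(\<lambda>n. real n ^ k)"
  proof (rule bigoI[where c = C], rule eventually_sequentiallyI[of 1])
    fix n :: nat assume "n \<ge> 1"
    moreover have "card (bip_class k n) > 0"
      using finite_bip_class bip_class_nonempty by (simp add: card_gt_0_iff)
    ultimately show "norm ((\<Sum>H \<in> bip_class k n. real (running_time prog k H)) / real (card (bip_class k n)))
        \<le> C * norm (real n ^ k)"
      using C[of n] by (simp add: sum_nonneg pos_divide_le_eq)
  qed
qed

end
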